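(* There is an absolute constant $c>0$ such that the following holds. For any $L>0$, $R>0$, $\chi\ge1$ and $\varepsilon>0$ with $L\ge 32\varepsilon/R^2$, there exist (1) a number $m$ of nodes, convex compact sets $\bar{\mathcal X},\bar{\mathcal Y},\mathcal P_i,\mathcal Q_i$ with all $\bar{\mathcal X}\times\mathcal P_i\times\bar{\mathcal Y}\times\mathcal Q_i$ of size $R$, and functions $f_i$ on $\bar{\mathcal X}\times\mathcal P_i\times\bar{\mathcal Y}\times\mathcal Q_i$ ($i=1,\dots,m$), each convex in $(x,p_i)$ for fixed $(y,q_i)$ and concave in $(y,q_i)$ for fixed $(x,p_i)$, whose average $f(x,\mathbf p,y,\mathbf q)=\frac1m\sum_{i=1}^m f_i(x,p_i,y,q_i)$ is $L$-smooth; and (2) a connected graph $\mathcal G$ on the $m$ nodes with an associated gossip matrix $W$ of condition number $\chi(W)=\chi$, such that for every decentralized algorithm that is a black-box procedure on $\mathcal G$ (as defined in the context, with local-step time $t$ and communication time $\tau$), if its final global output $(\hat x,\hat{\mathbf p},\hat y,\hat{\mathbf q})$ at time $T$ satisfies $$\max_{y\in\bar{\mathcal Y},\ \mathbf q\in\mathcal Q} f(\hat x,\hat{\mathbf p},y,\mathbf q)-\min_{x\in\bar{\mathcal X},\ \mathbf p\in\mathcal P}f(x,\mathbf p,\hat y,\hat{\mathbf q})\le\varepsilon,$$ then $$T\ \ge\ c\,\frac{LR^2}{\varepsilon}\,\big(t+\sqrt{\chi}\,\tau\big),$$ i.e. $T=\Omega\big(\frac{LR^2}{\varepsilon}(t+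\sqrt\chi\,\tau)\big)$.
   Context: **Setting.** Problem: $\min_{x\in\bar{\mathcal X},\mathbf p\in\mathcal P}\max_{y\in\bar{\mathcal Y},\mathbf q\in\mathcal Q}\frac1m\sum_{i=1}^mf_i(x,p_i,y,q_i)$, $\mathcal P=\prod_i\mathcal P_i$, $\mathcal Q=\prod_i\mathcal Q_i$; node $i$ holds $f_i$. The local variables $p_i,q_i$ are allowed to be void (dummy), in which case one simply has $\min_{x\in\bar{\mathcal X}}\max_{y\in\bar{\mathcal Y}}\frac1m\sum_i f_i(x,y)$ with $\bar{\mathcal X},\bar{\mathcal Y}\subset\mathbb R^d$ balls centred at $0$. The setup is Euclidean. A set $\mathcal T$ has size $R$ when $R^2=\max_{t,t'\in\mathcal T}\big(\frac12\|t\|_2^2-\frac12\|t'\|_2^2\big)$; "all the sets have size $R$" refers to each nonvoid factor ($\bar{\mathcal X}$, $\bar{\mathcal Y}$, ...). $L$-smooth means the gradient is $L$-Lipschitz in the Euclidean norm. **Gossip matrix** of $\mathcal G=(\mathcal V,\mathcal E)$: symmetric positive semidefinite $W\in\mathbb R^{m\times m}$ with $[W]_{ij}=0$ if $i\ne j$ and $(i,j)\notin\mathcal E$, and $\ker W=\mathrm{span}\{\mathbf 1\}$; $\chi(W)=\lambda_{\max}(W)/\lambda_{\min}^+(W)$. **Black-box procedure.** One local iteration costs $t$ time units and one communication round $\tau$ time units; communications and local updates may run in parallel and asynchronously. At time $T\ge0$ node $i$ has internal memories $H^x_{i,T},H^p_{i,T},H^y_{i,T},H^q_{i,T}$ (sets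 of vectors of the dimensions of $x,p_i,y,q_i$). *Initialization:* $H^x_{i,0}=H^p_{i,0}=H^y_{i,0}=H^q_{i,0}=\{0\}$ for all $i$. *Connection:* $H^x_{i,T}\subseteq\bar H^x_{i,T}\cup\hat H^x_{i,T}$, $H^p_{i,T}\subseteq\hat H^p_{i,T}$, $H^y_{i,T}\subseteq\bar H^y_{i,T}\cup\hat H^y_{i,T}$, $H^q_{i,T}\subseteq\hat H^q_{i,T}$. *Communication:* $\bar H^x_{i,T}\subseteq\mathrm{span}\{\bigcup_{(j,i)\in\mathcal E}H^x_{j,T-\tau}\}$, $\bar H^y_{i,T}\subseteq\mathrm{span}\{\bigcup_{(j,i)\in\mathcal E}H^y_{j,T-\tau}\}$. *Local computation:* $\hat H^x_{i,T}\subseteq\mathrm{span}\{x,\nabla_xf_i(x',p',y',q'),\mathrm{Mirr}(\gamma\nabla_xf_i(x',p',y',q');x;\bar{\mathcal X})\}$, $\hat H^p_{i,T}\subseteq\mathrm{span}\{p,\nabla_{p_i}f_i(x',p',y',q'),\mathrm{Mirr}(\gamma\nabla_{p_i}f_i(x',p',y',q');p;\mathcal P_i)\}$, $\hat H^y_{i,T}\subseteq\mathrm{span}\{y,\nabla_yf_i(x',p',y',q'),\mathrm{Mirr}(\gamma\nabla_yf_i(x',p',y',q');y;\bar{\mathcal Y})\}$, $\hat H^q_{i,T}\subseteq\mathrm{span}\{q,\nabla_{q_i}f_i(x',p',y',q'),\mathrm{Mirr}(\gamma\nabla_{q_i}f_i(x',p',y',q');q;\mathcal Q_i)\}$, where the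 spans are over all $x,x'\in H^x_{i,T-t}$, $p,p'\in H^p_{i,T-t}$, $y,y'\in H^y_{i,T-t}$, $q,q'\in H^q_{i,T-t}$ and all $\gamma\in\mathbb R$, and $\mathrm{Mirr}(g;u;\mathcal T)=\mathrm{proj}_{\mathcal T}(u-g)$ is the Euclidean projection. Updates can only start at nonnegative times; before any update is completed the memories are the initial ones. *Output:* when the algorithm ends at time $T$, the global output is some $\hat x\in\mathrm{span}\{\bigcup_iH^x_{i,T}\}$, $\hat p_i\in H^p_{i,T}$, $\hat y\in\mathrm{span}\{\bigcup_iH^y_{i,T}\}$, $\hat q_i\in H^q_{i,T}$. *)

theory Defs
  imports
    "Jordan_Normal_Form.Char_Poly"
    "Jordan_Normal_Form.Matrix_Kernel"
    "HOL-Library.Poly_Mapping"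
    "HOL-Analysis.Analysis"
begin

no_notation scalar_prod (infix \<open>\<bullet>\<close> 70)

subsection \<open>Euclidean spaces of varying dimension\<close>

text \<open>
  The dimensions of the blocks are existentially quantified, so they cannot be types.  All blocks
  therefore live in the inner product space of finitely supported real sequences, and
  \<open>\<real>\<^sup>d\<close> is the subspace of the sequences supported in \<open>{..<d}\<close> (\<open>Rn\<close> below).
\<close>

instantiation poly_mapping :: (type, real_vector) real_vector
begin

lift_definition scaleR_poly_mapping :: "real \<Rightarrow> ('a \<Rightarrow>\<^sub>0 'b) \<Rightarrow> 'a \<Rightarrow>\<^sub>0 'b"
  is "\<lambda>r f k. r *\<^sub>R f k"
  by (rule finite_subset[rotated]) auto

instance
  by standard (transfer; simp add: algebra_simps)+

end

instantiation poly_mapping :: (type, real_inner) real_inner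
begin

definition inner_poly_mapping :: "('a \<Rightarrow>\<^sub>0 'b) \<Rightarrow> ('a \<Rightarrow>\<^sub>0 'b) \<Rightarrow> real"
  where "inner f g = (\<Sum>k\<in>Poly_Mapping.keys f. Poly_Mapping.lookup f k \<bullet> Poly_Mapping.lookup g k)"

definition norm_poly_mapping :: "('a \<Rightarrow>\<^sub>0 'b) \<Rightarrow> real"
  where "norm (f :: 'a \<Rightarrow>\<^sub>0 'b) = sqrt (f \<bullet> f)"

definition sgn_poly_mapping :: "('a \<Rightarrow>\<^sub>0 'b) \<Rightarrow> 'a \<Rightarrow>\<^sub>0 'b"
  where "sgn (f :: 'a \<Rightarrow>\<^sub>0 'b) = f /\<^sub>R norm f"

definition dist_poly_mapping :: "('a \<Rightarrow>\<^sub>0 'b) \<Rightarrow> ('a \<Rightarrow>\<^sub>0 'b) \<Rightarrow> real"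
  where "dist (f :: 'a \<Rightarrow>\<^sub>0 'b) g = norm (f - g)"

definition uniformity_poly_mapping :: "(('a \<Rightarrow>\<^sub>0 'b) \<times> ('a \<Rightarrow>\<^sub>0 'b)) filter"
  where "(uniformity :: (('a \<Rightarrow>\<^sub>0 'b) \<times> ('a \<Rightarrow>\<^sub>0 'b)) filter) = (INF e\<in>{0 <..}. principal {(f, g). dist f g < e})"

definition open_poly_mapping :: "('a \<Rightarrow>\<^sub>0 'b) set \<Rightarrow> bool"
  where "open (U :: ('a \<Rightarrow>\<^sub>0 'b) set) \<longleftrightarrow> (\<forall>f\<in>U. eventually (\<lambda>(f', g). f' = f \<longrightarrow> g \<in> U) uniformity)"

instance
proof
  have inner_superset: "inner f g = (\<Sum>k\<in>A. Poly_Mapping.lookup f k \<bullet> Poly_Mapping.lookup g k)"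
    if "finite A" "Poly_Mapping.keys f \<subseteq> A" for A and f g :: "'a \<Rightarrow>\<^sub>0 'b"
    unfolding inner_poly_mapping_def using that
    by (intro sum.mono_neutral_left) (auto simp: in_keys_iff)
  fix f g h :: "'a \<Rightarrow>\<^sub>0 'b" and a :: real
  show "sgn f = f /\<^sub>R norm f" "dist f g = norm (f - g)" "norm f = sqrt (f \<bullet> f)"
    by (fact sgn_poly_mapping_def dist_poly_mapping_def norm_poly_mapping_def)+
  show "(uniformity :: (('a \<Rightarrow>\<^sub>0 'b) \<times> ('a \<Rightarrow>\<^sub>0 'b)) filter)
      = (INF e\<in>{0 <..}. principal {(f, g). dist f g < e})"
    by (fact uniformity_poly_mapping_def)
  show "open U = (\<forall>f\<in>U. \<forall>\<^sub>F (f', g) in uniformity. f' = f \<longrightarrow> g \<in> U)"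
    for U :: "('a \<Rightarrow>\<^sub>0 'b) set"
    by (fact open_poly_mapping_def)
  let ?A = "Poly_Mapping.keys f \<union> Poly_Mapping.keys g \<union> Poly_Mapping.keys (f + g)"
  have A: "finite ?A" by simp
  show "f \<bullet> g = g \<bullet> f"
    by (simp add: inner_superset[of ?A f g] inner_superset[of ?A g f] inner_commute le_supI1)
  show "(f + g) \<bullet> h = f \<bullet> h + g \<bullet> h"
    by (simp add: inner_superset[of ?A "f + g" h] inner_superset[of ?A f h]
        inner_superset[of ?A g h] le_supI1 lookup_add inner_add_left sum.distrib)
  have "Poly_Mapping.keys (a *\<^sub>R f) \<subseteq> Poly_Mapping.keys f"
    by transfer auto
  then show "(a *\<^sub>R f) \<bullet> g = a * (f \<bullet> g)"
    by (subst inner_superset[of "Poly_Mapping.keys f"])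
      (simp_all add: inner_poly_mapping_def scaleR_poly_mapping.rep_eq sum_distrib_left)
  show "0 \<le> f \<bullet> f"
    by (simp add: inner_poly_mapping_def sum_nonneg)
  show "f \<bullet> f = 0 \<longleftrightarrow> f = 0"
    by (auto simp: inner_poly_mapping_def sum_nonneg_eq_0_iff in_keys_iff intro!: poly_mapping_eqI)
qed

end

type_synonym rvec = "nat \<Rightarrow>\<^sub>0 real"

definition Rn :: "nat \<Rightarrow> rvec set"
  where "Rn d = {v. Poly_Mapping.keys v \<subseteq> {..<d}}"

text \<open>The gradient in \<open>\<real>\<^sup>d\<close>; \<open>grad_eqI\<close> shows that the description is unique.\<close>

definition grad :: "nat \<Rightarrow> (rvec \<Rightarrow> real) \<Rightarrow> rvec \<Rightarrow> rvec"
  where "grad d \<phi> u =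
    (THE g. g \<in> Rn d \<and> (\<phi> has_derivative (\<lambda>h. g \<bullet> h)) (at u within Rn d))"

lemma subspace_Rn: "Real_Vector_Spaces.subspace (Rn d)"
  unfolding Real_Vector_Spaces.subspace_def Rn_def
  by (auto simp: in_keys_iff lookup_add scaleR_poly_mapping.rep_eq subset_iff)
     (metis add.right_neutral)

lemma grad_eqI:
  assumes u: "u \<in> Rn d" and g: "g \<in> Rn d"
    and D: "(\<phi> has_derivative (\<lambda>h. g \<bullet> h)) (at u within Rn d)"
  shows "grad d \<phi> u = g"
  unfolding grad_def
proof (rule the_equality)
  show "g \<in> Rn d \<and> (\<phi> has_derivative (\<lambda>h. g \<bullet> h)) (at u within Rn d)"
    using g D by blast
next
  fix g' assume g': "g' \<in> Rn d \<and> (\<phi> has_derivative (\<lambda>h. g' \<bullet> h)) (at u within Rn d)"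
  let ?h = "g - g'"
  have h: "?h \<in> Rn d"
    using g g' subspace_Rn Real_Vector_Spaces.subspace_diff by blast
  have line: "((\<lambda>s. u + s *\<^sub>R ?h) has_derivative (\<lambda>s. s *\<^sub>R ?h)) (at 0 within UNIV)"
    by (auto intro!: derivative_eq_intros)
  have dir: "((\<lambda>s::real. \<phi> (u + s *\<^sub>R ?h)) has_derivative (\<lambda>s. v \<bullet> (s *\<^sub>R ?h))) (at 0)"
    if "(\<phi> has_derivative (\<lambda>h. v \<bullet> h)) (at u within Rn d)" for v
  proof -
    have "(\<phi> has_derivative (\<lambda>h. v \<bullet> h)) (at (u + 0 *\<^sub>R ?h) within range (\<lambda>s. u + s *\<^sub>R ?h))"
      using u h subspace_Rn
      by (auto intro!: has_derivative_subset[OF that]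
          intro: Real_Vector_Spaces.subspace_add Real_Vector_Spaces.subspace_scale)
    from has_derivative_in_compose[OF line this] show ?thesis .
  qed
  have "(\<lambda>s::real. g \<bullet> (s *\<^sub>R ?h)) = (\<lambda>s. g' \<bullet> (s *\<^sub>R ?h))"
    using has_derivative_unique[OF dir[OF D] dir[of g']] g' by blast
  from fun_cong[OF this, of 1] have "?h \<bullet> ?h = 0"
    by (simp add: inner_diff_left)
  then show "g' = g" by simp
qed

text \<open>Same description as \<^const>\<open>closest_point\<close>, whose type class excludes \<^typ>\<open>rvec\<close>.\<close>

definition proj :: "rvec set \<Rightarrow> rvec \<Rightarrow> rvec"
  where "proj S a = (SOME v. v \<in> S \<and> (\<forall>w\<in>S. dist a v \<le> dist a w))"

definition Mirr :: "rvec \<Rightarrow> rvec \<Rightarrow> rvec set \<Rightarrow> rvec"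
  where "Mirr g u S = proj S (u - g)"

definition has_size :: "rvec set \<Rightarrow> real \<Rightarrow> bool"
  where "has_size S R \<longleftrightarrow>
    (\<exists>a\<in>S. \<exists>b\<in>S. R\<^sup>2 = (norm a)\<^sup>2 / 2 - (norm b)\<^sup>2 / 2) \<and>
    (\<forall>a\<in>S. \<forall>b\<in>S. (norm a)\<^sup>2 / 2 - (norm b)\<^sup>2 / 2 \<le> R\<^sup>2)"


subsection \<open>Distributed saddle point problems\<close>

text \<open>
  The nodes are \<open>0, \<dots>, nodes - 1\<close>.  The function of node \<open>i\<close> is given on the whole of
  \<open>\<real>\<^bsup>dim_x\<^esup> \<times> \<real>\<^bsup>dim_p i\<^esup> \<times> \<real>\<^bsup>dim_y\<^esup> \<times> \<real>\<^bsup>dim_q i\<^esup>\<close>, since the memories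
  of a black-box procedure need not stay inside the constraint sets; convexity, concavity and
  smoothness are only required on the constraint sets.  A void local variable is one
  of dimension \<open>0\<close>.
\<close>

record saddle_problem =
  nodes :: nat
  dim_x :: nat
  dim_p :: "nat \<Rightarrow> nat"
  dim_y :: nat
  dim_q :: "nat \<Rightarrow> nat"
  set_x :: "rvec set"
  set_p :: "nat \<Rightarrow> rvec set"
  set_y :: "rvec set"
  set_q :: "nat \<Rightarrow> rvec set"
  node_fun :: "nat \<Rightarrow> rvec \<Rightarrow> rvec \<Rightarrow> rvec \<Rightarrow> rvec \<Rightarrow> real"

definition avg_fun ::
  "saddle_problem \<Rightarrow> rvec \<Rightarrow> (nat \<Rightarrow> rvec) \<Rightarrow> rvec \<Rightarrow> (nat \<Rightarrow> rvec) \<Rightarrow> real"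
  where "avg_fun A x p y q =
    (\<Sum>i<nodes A. node_fun A i x (p i) y (q i)) / real (nodes A)"

definition prod_p :: "saddle_problem \<Rightarrow> (nat \<Rightarrow> rvec) set"
  where "prod_p A = PiE {..<nodes A} (set_p A)"

definition prod_q :: "saddle_problem \<Rightarrow> (nat \<Rightarrow> rvec) set"
  where "prod_q A = PiE {..<nodes A} (set_q A)"

definition admissible_sets :: "saddle_problem \<Rightarrow> real \<Rightarrow> bool"
  where "admissible_sets A R \<longleftrightarrow>
    set_x A \<subseteq> Rn (dim_x A) \<and> convex (set_x A) \<and> compact (set_x A) \<and> has_size (set_x A) R \<and>
    set_y A \<subseteq> Rn (dim_y A) \<and> convex (set_y A) \<and> compact (set_y A) \<and> has_size (set_y A) R \<and>
    (\<forall>i<nodes A.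
      set_p A i \<subseteq> Rn (dim_p A i) \<and> convex (set_p A i) \<and> compact (set_p A i) \<and> set_p A i \<noteq> {} \<and>
      (dim_p A i \<noteq> 0 \<longrightarrow> has_size (set_p A i) R) \<and>
      set_q A i \<subseteq> Rn (dim_q A i) \<and> convex (set_q A i) \<and> compact (set_q A i) \<and> set_q A i \<noteq> {} \<and>
      (dim_q A i \<noteq> 0 \<longrightarrow> has_size (set_q A i) R))"

definition differentiable_nodes :: "saddle_problem \<Rightarrow> bool"
  where "differentiable_nodes A \<longleftrightarrow> (\<forall>i<nodes A.
    (\<lambda>(x, p, y, q). node_fun A i x p y q) differentiable_on
      (Rn (dim_x A) \<times> Rn (dim_p A i) \<times> Rn (dim_y A) \<times> Rn (dim_q A i)))"

definition convex_concave :: "saddle_problem \<Rightarrow> bool"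
  where "convex_concave A \<longleftrightarrow> (\<forall>i<nodes A.
    (\<forall>y\<in>set_y A. \<forall>q\<in>set_q A i.
      convex_on (set_x A \<times> set_p A i) (\<lambda>(x, p). node_fun A i x p y q)) \<and>
    (\<forall>x\<in>set_x A. \<forall>p\<in>set_p A i.
      concave_on (set_y A \<times> set_q A i) (\<lambda>(y, q). node_fun A i x p y q)))"

text \<open>
  The full gradient of the average is the tuple of its block gradients, measured in the Euclidean
  norm of the product space.
\<close>

definition block_norm ::
  "nat \<Rightarrow> rvec \<Rightarrow> (nat \<Rightarrow> rvec) \<Rightarrow> rvec \<Rightarrow> (nat \<Rightarrow> rvec) \<Rightarrow> real"
  where "block_norm m x p y q =
    sqrt ((norm x)\<^sup>2 + (\<Sum>i<m. (norm (p i))\<^sup>2) + (norm y)\<^sup>2 + (\<Sum>i<m. (norm (q i))\<^sup>2))"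

definition grad_x where
  "grad_x A x p y q = grad (dim_x A) (\<lambda>u. avg_fun A u p y q) x"

definition grad_p where
  "grad_p A x p y q i = grad (dim_p A i) (\<lambda>u. avg_fun A x (p(i := u)) y q) (p i)"

definition grad_y where
  "grad_y A x p y q = grad (dim_y A) (\<lambda>u. avg_fun A x p u q) y"

definition grad_q where
  "grad_q A x p y q i = grad (dim_q A i) (\<lambda>u. avg_fun A x p y (q(i := u))) (q i)"

definition avg_smooth :: "saddle_problem \<Rightarrow> real \<Rightarrow> bool"
  where "avg_smooth A L \<longleftrightarrow>
    (\<forall>x\<in>set_x A. \<forall>p\<in>prod_p A. \<forall>y\<in>set_y A. \<forall>q\<in>prod_q A.
     \<forall>x'\<in>set_x A. \<forall>p'\<in>prod_p A. \<forall>y'\<in>set_y A. \<forall>q'\<in>prod_q A.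
      block_norm (nodes A)
        (grad_x A x p y q - grad_x A x' p' y' q')
        (\<lambda>i. grad_p A x p y q i - grad_p A x' p' y' q' i)
        (grad_y A x p y q - grad_y A x' p' y' q')
        (\<lambda>i. grad_q A x p y q i - grad_q A x' p' y' q' i)
      \<le> L * block_norm (nodes A) (x - x') (\<lambda>i. p i - p' i) (y - y') (\<lambda>i. q i - q' i))"

text \<open>The maximum and the minimum are attained: continuous functions on compact sets.\<close>

definition saddle_gap ::
  "saddle_problem \<Rightarrow> rvec \<Rightarrow> (nat \<Rightarrow> rvec) \<Rightarrow> rvec \<Rightarrow> (nat \<Rightarrow> rvec) \<Rightarrow> real"
  where "saddle_gap A x p y q =
    (SUP (y', q') \<in> set_y A \<times> prod_q A. avg_fun A x p y' q') -
    (INF (x', p') \<in> set_x A \<times> prod_p A. avg_fun A x' p' y q)"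


subsection \<open>Communication graph and gossip matrix\<close>

definition connected_graph :: "nat \<Rightarrow> (nat \<times> nat) set \<Rightarrow> bool"
  where "connected_graph m E \<longleftrightarrow>
    0 < m \<and> E \<subseteq> {..<m} \<times> {..<m} \<and> sym E \<and> irrefl E \<and> (\<forall>i<m. \<forall>j<m. (i, j) \<in> E\<^sup>*)"

definition gossip_matrix :: "nat \<Rightarrow> (nat \<times> nat) set \<Rightarrow> real mat \<Rightarrow> bool"
  where "gossip_matrix m E W \<longleftrightarrow>
    W \<in> carrier_mat m m \<and> transpose_mat W = W \<and>
    (\<forall>v\<in>carrier_vec m. 0 \<le> scalar_prod v (W *\<^sub>v v)) \<and>
    (\<forall>i<m. \<forall>j<m. i \<noteq> j \<and> (i, j) \<notin> E \<longrightarrow> W $$ (i, j) = 0) \<and>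
    mat_kernel W = {a \<cdot>\<^sub>v Matrix.vec m (\<lambda>_. 1) | a. True}"

definition chi :: "real mat \<Rightarrow> real"
  where "chi W = Max {k. eigenvalue W k} / Min {k. eigenvalue W k \<and> 0 < k}"


subsection \<open>Black-box procedures\<close>

text \<open>
  \<open>comm_set\<close> and \<open>local_set\<close> are the largest sets a communication round, respectively a local
  iteration, completed at time \<open>s\<close> can produce.  A step completed at time \<open>s\<close> has started at
  \<open>s - \<tau>\<close>, respectively \<open>s - t\<close>; as long as this is negative only the initial memory \<open>{0}\<close> is
  available.  In \<open>local_set\<close>, \<open>G\<close> is the set of gradients that can be queried and \<open>U\<close> the
  memory of the block at the start of the step.
\<close>

definition comm_set ::
  "(nat \<times> nat) set \<Rightarrow> real \<Rightarrow> (nat \<Rightarrow> real \<Rightarrow> rvec set) \<Rightarrow> nat \<Rightarrow> real \<Rightarrow> rvec set"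
  where "comm_set E \<tau> H i s =
    (if s < \<tau> then {0} else span (\<Union>j\<in>{j. (j, i) \<in> E}. H j (s - \<tau>)))"

definition local_set ::
  "real \<Rightarrow> real \<Rightarrow> rvec set \<Rightarrow> rvec set \<Rightarrow> rvec set \<Rightarrow> rvec set"
  where "local_set t s S G U =
    (if s < t then {0}
     else span (\<Union>u\<in>U. \<Union>g\<in>G. \<Union>\<gamma>::real. {u, g, Mirr (\<gamma> *\<^sub>R g) u S}))"

definition black_box ::
  "saddle_problem \<Rightarrow> (nat \<times> nat) set \<Rightarrow> real \<Rightarrow> real \<Rightarrow>
   (nat \<Rightarrow> real \<Rightarrow> rvec set) \<Rightarrow> (nat \<Rightarrow> real \<Rightarrow> rvec set) \<Rightarrow>
   (nat \<Rightarrow> real \<Rightarrow> rvec set) \<Rightarrow> (nat \<Rightarrow> real \<Rightarrow> rvec set) \<Rightarrow> bool"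
  where "black_box A E t \<tau> Hx Hp Hy Hq \<longleftrightarrow> (\<forall>i<nodes A.
    Hx i 0 = {0} \<and> Hp i 0 = {0} \<and> Hy i 0 = {0} \<and> Hq i 0 = {0} \<and>
    (\<forall>s\<ge>0.
      let X = Hx i (s - t); P = Hp i (s - t); Y = Hy i (s - t); Q = Hq i (s - t);
          f = node_fun A i
      in
        Hx i s \<subseteq> comm_set E \<tau> Hx i s \<union> local_set t s (set_x A)
          {grad (dim_x A) (\<lambda>u. f u p y q) x | x p y q. x \<in> X \<and> p \<in> P \<and> y \<in> Y \<and> q \<in> Q} X \<and>
        Hp i s \<subseteq> local_set t s (set_p A i)
          {grad (dim_p A i) (\<lambda>u. f x u y q) p | x p y q. x \<in> X \<and> p \<in> P \<and> y \<in> Y \<and> q \<in> Q} P \<and>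
        Hy i s \<subseteq> comm_set E \<tau> Hy i s \<union> local_set t s (set_y A)
          {grad (dim_y A) (\<lambda>u. f x p u q) y | x p y q. x \<in> X \<and> p \<in> P \<and> y \<in> Y \<and> q \<in> Q} Y \<and>
        Hq i s \<subseteq> local_set t s (set_q A i)
          {grad (dim_q A i) (\<lambda>u. f x p y u) q | x p y q. x \<in> X \<and> p \<in> P \<and> y \<in> Y \<and> q \<in> Q} Q))"

definition global_output ::
  "saddle_problem \<Rightarrow>
   (nat \<Rightarrow> real \<Rightarrow> rvec set) \<Rightarrow> (nat \<Rightarrow> real \<Rightarrow> rvec set) \<Rightarrow>
   (nat \<Rightarrow> real \<Rightarrow> rvec set) \<Rightarrow> (nat \<Rightarrow> real \<Rightarrow> rvec set) \<Rightarrow> real \<Rightarrow>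
   rvec \<Rightarrow> (nat \<Rightarrow> rvec) \<Rightarrow> rvec \<Rightarrow> (nat \<Rightarrow> rvec) \<Rightarrow> bool"
  where "global_output A Hx Hp Hy Hq T x p y q \<longleftrightarrow>
    x \<in> span (\<Union>i<nodes A. Hx i T) \<and> (\<forall>i<nodes A. p i \<in> Hp i T) \<and>
    y \<in> span (\<Union>i<nodes A. Hy i T) \<and> (\<forall>i<nodes A. q i \<in> Hq i T)"

end

theory Submission
  imports Defs
begin

text \<open>
  The objective is the bilinear chain \<open>\<mu> (y \<bullet> (x - shift x) - \<beta> y\<^sub>0)\<close>, whose coordinates are linked in the order
  \<open>y\<^sub>0, x\<^sub>0, y\<^sub>1, x\<^sub>1, \<dots>\<close>.  The links \<open>y\<^sub>k x\<^sub>k\<close> belong to one end of a graph, the links \<open>y\<^sub>k\<^sub>+\<^sub>1 x\<^sub>k\<close> and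
  the source \<open>\<beta> y\<^sub>0\<close> to the other end, so that every new coordinate costs a local step and a trip
  across the graph.  As long as \<open>x\<^sub>N\<^sub>-\<^sub>1\<close> has not been reached, the residual \<open>x - shift x - \<beta> e\<^sub>0\<close> has
  coordinate sum \<open>- \<beta>\<close>, hence norm at least \<open>\<beta> / sqrt N\<close>, while it vanishes at the constant vector;
  with \<open>\<beta> = r / sqrt N\<close> the gap is at least \<open>\<mu> r\<^sup>2 / N\<close>.

  The graph is a path of \<open>n\<close> levels with twin nodes \<open>2 l\<close>, \<open>2 l + 1\<close> on level \<open>l\<close>.  With the weights
  \<open>w\<^sub>l = l (n - l)\<close> between the levels, all positive eigenvalues of the path part lie between \<open>4\<close>, which is
  attained, and \<open>2 (n\<^sup>2 - 2)\<close>; the differences of twins are eigenvectors whose common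
  eigenvalue can be set to \<open>4 \<kappa>\<close> freely.  This gives \<open>\<chi> = \<kappa>\<close> exactly, with diameter of order \<open>sqrt \<kappa>\<close>.
\<close>

no_notation Finite_Cartesian_Product.vec.vec_nth (infixl \<open>$\<close> 90)

subsection \<open>Balls in the space of finitely supported sequences\<close>

definition basis_vec :: "nat \<Rightarrow> rvec"
  where "basis_vec k = Poly_Mapping.single k 1"

lemma lookup_basis_vec [simp]: "Poly_Mapping.lookup (basis_vec k) j = (if j = k then 1 else 0)"
  by (simp add: basis_vec_def lookup_single when_def)

lemma lookup_scaleR [simp]:
  "Poly_Mapping.lookup (a *\<^sub>R v) k = a *\<^sub>R Poly_Mapping.lookup v k"
  by (simp add: scaleR_poly_mapping.rep_eq)

lemma inner_rvec_eq_sum: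
  fixes x y :: rvec
  assumes "finite K" "Poly_Mapping.keys x \<subseteq> K"
  shows "x \<bullet> y = (\<Sum>k\<in>K. Poly_Mapping.lookup x k * Poly_Mapping.lookup y k)"
  unfolding inner_poly_mapping_def using assms
  by (simp, intro sum.mono_neutral_left) (auto simp: in_keys_iff)

lemma inner_Rn:
  "x \<in> Rn d \<Longrightarrow> x \<bullet> y = (\<Sum>k<d. Poly_Mapping.lookup x k * Poly_Mapping.lookup y k)"
  by (rule inner_rvec_eq_sum) (auto simp: Rn_def)

lemma inner_basis_vec [simp]: "x \<bullet> basis_vec k = Poly_Mapping.lookup x k"
  by (subst inner_commute, subst inner_rvec_eq_sum[of "{k}"]) (auto simp: basis_vec_def)

lemma norm_basis_vec [simp]: "norm (basis_vec k) = 1"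
  unfolding norm_eq_sqrt_inner inner_basis_vec by simp

lemma norm_Rn: "x \<in> Rn d \<Longrightarrow> (norm x)\<^sup>2 = (\<Sum>k<d. (Poly_Mapping.lookup x k)\<^sup>2)"
  unfolding power2_norm_eq_inner by (simp add: inner_Rn power2_eq_square)

lemma Rn_iff: "x \<in> Rn d \<longleftrightarrow> (\<forall>k\<ge>d. Poly_Mapping.lookup x k = 0)"
  unfolding Rn_def by (auto simp: in_keys_iff subset_iff not_le[symmetric])

lemma subspace_keys: "Real_Vector_Spaces.subspace {v :: rvec. \<forall>k\<in>Poly_Mapping.keys v. P k}"
  unfolding Real_Vector_Spaces.subspace_def
  by (auto simp: in_keys_iff lookup_add; metis add_0)

lemma continuous_on_lookup [continuous_intros]:
  "continuous_on S f \<Longrightarrow> continuous_on S (\<lambda>x. Poly_Mapping.lookup (f x :: rvec) k)"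
  unfolding inner_basis_vec[symmetric] by (intro continuous_intros)

definition Rn_ball :: "nat \<Rightarrow> real \<Rightarrow> rvec set"
  where "Rn_ball d r = {v \<in> Rn d. norm v \<le> r}"

lemma closed_Rn_ball: "closed (Rn_ball d r)"
proof -
  have "Rn_ball d r = (\<Inter>k\<in>{d..}. {v. Poly_Mapping.lookup v k = 0}) \<inter> {v. norm v \<le> r}"
    by (auto simp: Rn_ball_def Rn_iff)
  moreover have "closed {v :: rvec. Poly_Mapping.lookup v k = 0}" for k
    by (intro closed_Collect_eq continuous_intros)
  moreover have "closed {v :: rvec. norm v \<le> r}"
    by (intro closed_Collect_le continuous_intros)
  ultimately show ?thesis by (metis (no_types, lifting) closed_INT closed_Int)
qed

lemma abs_lookup_le_norm: "\<bar>Poly_Mapping.lookup x k\<bar> \<le> norm (x :: rvec)"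
  using Cauchy_Schwarz_ineq2[of x "basis_vec k"]
  by simp

text \<open>Induction on the dimension: splitting off the last coordinate embeds the ball as a
  closed subset of the continuous image of a compact ball times an interval.\<close>

lemma compact_Rn_ball: "compact (Rn_ball d r)"
proof (induction d)
  case 0
  have "Rn_ball 0 r \<subseteq> {0}"
    unfolding Rn_ball_def Rn_iff by (blast intro: poly_mapping_eqI[of _ 0, simplified])
  then show ?case
    using finite_imp_compact finite_subset by blast
next
  case (Suc d)
  let ?g = "\<lambda>(v :: rvec, c :: real). v + c *\<^sub>R basis_vec d"
  have "compact (?g ` (Rn_ball d r \<times> {- r..r}))"
    by (intro compact_continuous_image compact_Times Suc compact_Icc)
      (auto simp: split_beta intro!: continuous_intros)
  moreover have "Rn_ball (Suc d) r \<subseteq> ?g ` (Rn_ball d r \<times> {- r..r})"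
  proof
    fix v assume v: "v \<in> Rn_ball (Suc d) r"
    define c where "c = Poly_Mapping.lookup v d"
    define u where "u = v - c *\<^sub>R basis_vec d"
    have c: "c \<in> {- r..r}"
      using abs_lookup_le_norm[of v d] v by (auto simp: c_def Rn_ball_def)
    have uR: "u \<in> Rn d"
      using v by (auto simp: u_def c_def Rn_ball_def Rn_iff lookup_minus)
    have "(norm u)\<^sup>2 \<le> (norm v)\<^sup>2"
      using v uR
      by (simp add: Rn_ball_def norm_Rn[of u d] norm_Rn[of v "Suc d"])
        (intro add_increasing2 sum_mono, auto simp: u_def lookup_minus)
    then have "norm u \<le> r"
      using v by (auto simp: Rn_ball_def dest!: power2_le_imp_le)
    with uR have "u \<in> Rn_ball d r" by (simp add: Rn_ball_def)
    moreover have "v = ?g (u, c)" by (simp add: u_def)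
    ultimately show "v \<in> ?g ` (Rn_ball d r \<times> {- r..r})" using c by blast
  qed
  ultimately show ?case
    using closed_Rn_ball compact_Int_closed by (metis Int_absorb1)
qed

lemma convex_Rn_ball: "convex (Rn_ball d r)"
proof -
  have "Rn_ball d r = Rn d \<inter> cball 0 r" by (auto simp: Rn_ball_def)
  then show ?thesis
    by (simp add: convex_Int subspace_imp_convex[OF subspace_Rn])
qed

text \<open>Half the squared norm ranges from \<open>0\<close> at the centre to half the squared
  radius, which equals the squared size exactly when the radius is
  \<open>sqrt 2 * R\<close>.\<close>

lemma has_size_Rn_ball:
  assumes "0 < d" "0 < R"
  shows "has_size (Rn_ball d (sqrt 2 * R)) R"
proof -
  define e where "e = (sqrt 2 * R) *\<^sub>R basis_vec 0"
  have ne: "norm e = sqrt 2 * R"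
    using assms by (simp add: e_def)
  have "e \<in> Rn_ball d (sqrt 2 * R)"
    unfolding Rn_ball_def using ne assms(1)
    by (auto simp: Rn_iff e_def)
  moreover have "0 \<in> Rn_ball d (sqrt 2 * R)"
    using assms by (auto simp: Rn_ball_def Rn_iff)
  moreover have "(norm a)\<^sup>2 / 2 - (norm b)\<^sup>2 / 2 \<le> R\<^sup>2"
    if "a \<in> Rn_ball d (sqrt 2 * R)" for a b :: rvec
  proof -
    have "(norm a)\<^sup>2 \<le> (sqrt 2 * R)\<^sup>2"
      using that by (intro power_mono) (auto simp: Rn_ball_def)
    then have "(norm a)\<^sup>2 \<le> 2 * R\<^sup>2" by (simp add: power_mult_distrib)
    then show ?thesis using zero_le_power2[of "norm b"] by linarith
  qed
  ultimately show ?thesis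
    unfolding has_size_def using ne
    by (intro conjI ballI bexI[of _ e] bexI[of _ 0]) (auto simp: power_mult_distrib)
qed

text \<open>Zeroing the coordinates outside the support of \<open>a\<close> keeps a vector in the ball and brings it
  strictly closer to \<open>a\<close>.\<close>

lemma keys_proj_Rn_ball:
  assumes "0 \<le> r"
  shows "Poly_Mapping.keys (proj (Rn_ball d r) a) \<subseteq> Poly_Mapping.keys a"
proof -
  define v where "v = proj (Rn_ball d r) a"
  have "0 \<in> Rn_ball d r"
    using assms by (simp add: Rn_ball_def Rn_iff)
  then have "Rn_ball d r \<noteq> {}" by blast
  moreover have "continuous_on (Rn_ball d r) (dist a)" by (intro continuous_intros)
  \<comment> \<open>Existence of a minimiser is what gives the choice operator in
    \<open>proj\<close> its meaning.\<close>
  ultimately have "\<exists>v. v \<in> Rn_ball d r \<and> (\<forall>w\<in>Rn_ball d r. dist a v \<le> dist a w)"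
    using continuous_attains_inf[OF compact_Rn_ball] by blast
  from someI_ex[OF this]
  have v: "v \<in> Rn_ball d r" and vmin: "\<And>w. w \<in> Rn_ball d r \<Longrightarrow> dist a v \<le> dist a w"
    unfolding v_def proj_def by blast+
  show ?thesis
  proof (rule ccontr)
    assume "\<not> ?thesis"
    then obtain k where k: "Poly_Mapping.lookup a k = 0" "Poly_Mapping.lookup v k \<noteq> 0"
      by (auto simp: v_def in_keys_iff)
    define c where "c = Poly_Mapping.lookup v k"
    define w where "w = v - c *\<^sub>R basis_vec k"
    have ee: "basis_vec k \<bullet> basis_vec k = 1" by simp
    have "(norm w)\<^sup>2 = (norm v)\<^sup>2 - c\<^sup>2"
      unfolding w_def power2_norm_eq_inner
      by (simp add: inner_diff inner_commute[of "basis_vec k"] c_def power2_eq_square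
          lookup_minus)
    then have "norm w \<le> norm v"
      by (auto intro: power2_le_imp_le)
    then have "w \<in> Rn_ball d r"
      using v by (auto simp: Rn_ball_def Rn_iff w_def c_def lookup_minus)
    then have "dist a v \<le> dist a w" by (rule vmin)
    moreover have "(norm (a - w))\<^sup>2 = (norm (a - v))\<^sup>2 - c\<^sup>2"
    proof -
      have ze: "(a - v) \<bullet> basis_vec k = - c" "basis_vec k \<bullet> (a - v) = - c"
        using k(1) by (simp_all add: lookup_minus c_def inner_commute[of "basis_vec k"])
      have "a - w = (a - v) + c *\<^sub>R basis_vec k" by (simp add: w_def)
      then show ?thesis
        using ze unfolding power2_norm_eq_inner
        by (simp only: inner_add_left inner_add_right inner_scaleR_left inner_scaleR_right ee)
          (simp add: power2_eq_square)
    qed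
    then have "norm (a - w) < norm (a - v)"
      using k(2) by (simp add: c_def power2_less_imp_less)
    ultimately show False by (simp add: dist_norm)
  qed
qed

subsection \<open>A gossip matrix with prescribed condition number\<close>

lemma sum_lessThan_double:
  "(\<Sum>i<2 * n. f i) = (\<Sum>j<n. f (2 * j) + f (Suc (2 * j)))" for f :: "nat \<Rightarrow> 'a::comm_monoid_add"
  by (induction n) (auto simp: add_ac)

text \<open>Incidence vector of the link between levels \<open>l - 1\<close> and \<open>l\<close>.
  Truncated subtraction makes it vanish at \<open>l = 0\<close>; at \<open>l = n\<close> it does not
  vanish, but \<open>level_weight\<close> does, so sums over \<open>l\<close> need no boundary
  cases.\<close>

definition level_diff :: "nat \<Rightarrow> nat \<Rightarrow> real"
  where "level_diff l i = of_bool (i div 2 = l) - of_bool (i div 2 = l - 1)"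

definition twin_diff :: "nat \<Rightarrow> nat \<Rightarrow> real"
  where "twin_diff j i = of_bool (i = 2 * j) - of_bool (i = Suc (2 * j))"

definition level_weight :: "nat \<Rightarrow> nat \<Rightarrow> real"
  where "level_weight n l = real l * (real n - real l)"

text \<open>A weighted sum of rank-one squares. The first sum sees only the sums over levels, the
  second only the differences of twins, so the spectral problem splits into two independent
  parts.\<close>

definition ladder_matrix :: "nat \<Rightarrow> real \<Rightarrow> real mat"
  where "ladder_matrix n \<kappa> = Matrix.mat (2 * n) (2 * n) (\<lambda>(i, i').
    (\<Sum>l\<le>n. level_weight n l * level_diff l i * level_diff l i') +
    2 * \<kappa> * (\<Sum>j<n. twin_diff j i * twin_diff j i'))"

definition ladder_edges :: "nat \<Rightarrow> (nat \<times> nat) set"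
  where "ladder_edges n = {(i, i'). i < 2 * n \<and> i' < 2 * n \<and> i \<noteq> i' \<and>
    i div 2 \<le> Suc (i' div 2) \<and> i' div 2 \<le> Suc (i div 2)}"

text \<open>The weighted jump of the level sums across link \<open>l\<close>; the path part of the
  matrix is the discrete divergence of this flux.\<close>

definition level_flux :: "nat \<Rightarrow> (nat \<Rightarrow> real) \<Rightarrow> nat \<Rightarrow> real"
  where "level_flux n u l = level_weight n l * (\<Sum>i<2 * n. level_diff l i * u i)"

lemma level_weight_bounds [simp]: "level_weight n 0 = 0" "level_weight n n = 0"
  by (simp_all add: level_weight_def)

lemma level_weight_pos: "0 < l \<Longrightarrow> l < n \<Longrightarrow> 0 < level_weight n l"
  by (simp add: level_weight_def)

lemma level_flux_bounds [simp]: "level_flux n u 0 = 0" "level_flux n u n = 0"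
  by (simp_all add: level_flux_def)

lemma level_flux_eq:
  assumes "0 < l" "l < n"
  shows "level_flux n u l = level_weight n l *
    (u (2 * l) + u (Suc (2 * l)) - u (2 * (l - 1)) - u (Suc (2 * (l - 1))))"
proof -
  have "(\<Sum>i<2 * n. level_diff l i * u i)
      = (\<Sum>j<n. (if j = l then u (2 * j) + u (Suc (2 * j)) else 0)
          - (if j = l - 1 then u (2 * j) + u (Suc (2 * j)) else 0))"
    unfolding sum_lessThan_double by (intro sum.cong) (auto simp: level_diff_def)
  also have "\<dots> = u (2 * l) + u (Suc (2 * l)) - u (2 * (l - 1)) - u (Suc (2 * (l - 1)))"
    using assms by (simp add: sum_subtractf sum.delta less_imp_diff_less)
  finally show ?thesis by (simp add: level_flux_def)
qed

lemma twin_diff_sum: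
  assumes "j < n"
  shows "(\<Sum>i<2 * n. twin_diff j i * u i) = u (2 * j) - u (Suc (2 * j))"
proof -
  have "(\<Sum>i<2 * n. twin_diff j i * u i)
      = (\<Sum>j'<n. if j' = j then u (2 * j') - u (Suc (2 * j')) else 0)"
    unfolding sum_lessThan_double by (intro sum.cong) (auto simp: twin_diff_def)
  then show ?thesis using assms by (simp add: sum.delta)
qed

lemma ladder_matrix_carrier [simp]: "ladder_matrix n \<kappa> \<in> carrier_mat (2 * n) (2 * n)"
  "dim_row (ladder_matrix n \<kappa>) = 2 * n" "dim_col (ladder_matrix n \<kappa>) = 2 * n"
  by (simp_all add: ladder_matrix_def)

lemma ladder_mult_vec:
  assumes v: "v \<in> carrier_vec (2 * n)" and i: "i < 2 * n"
  shows "(ladder_matrix n \<kappa> *\<^sub>v v) $ i =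
    (\<Sum>l\<le>n. level_diff l i * level_flux n (($) v) l) +
    2 * \<kappa> * (\<Sum>j<n. twin_diff j i * (\<Sum>i'<2 * n. twin_diff j i' * v $ i'))"
proof -
  have "(ladder_matrix n \<kappa> *\<^sub>v v) $ i = (\<Sum>i'<2 * n.
      ((\<Sum>l\<le>n. level_weight n l * level_diff l i * level_diff l i') +
      2 * \<kappa> * (\<Sum>j<n. twin_diff j i * twin_diff j i')) * v $ i')"
    using v i by (simp add: ladder_matrix_def scalar_prod_def atLeast0LessThan)
  also have "\<dots> = (\<Sum>i'<2 * n. \<Sum>l\<le>n. level_weight n l * level_diff l i * level_diff l i' * v $ i') +
      2 * \<kappa> * (\<Sum>i'<2 * n. \<Sum>j<n. twin_diff j i * twin_diff j i' * v $ i')"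
    by (simp add: distrib_right sum.distrib sum_distrib_left sum_distrib_right mult.assoc)
  also have "\<dots> = (\<Sum>l\<le>n. \<Sum>i'<2 * n. level_weight n l * level_diff l i * level_diff l i' * v $ i') +
      2 * \<kappa> * (\<Sum>j<n. \<Sum>i'<2 * n. twin_diff j i * twin_diff j i' * v $ i')"
    by (subst sum.swap, subst (2) sum.swap) simp
  also have "\<dots> = (\<Sum>l\<le>n. level_diff l i * level_flux n (($) v) l) +
      2 * \<kappa> * (\<Sum>j<n. twin_diff j i * (\<Sum>i'<2 * n. twin_diff j i' * v $ i'))"
    by (simp add: level_flux_def sum_distrib_left mult_ac)
  finally show ?thesis .
qed

text \<open>Only the two links bordering its level and its own pair of twins contribute to row
  \<open>i\<close>; the parity of \<open>i\<close> gives the sign of the twin term.\<close>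

lemma ladder_mult_vec_eq:
  assumes v: "v \<in> carrier_vec (2 * n)" and i: "i < 2 * n" and j: "j = i div 2"
  shows "(ladder_matrix n \<kappa> *\<^sub>v v) $ i =
    level_flux n (($) v) j - level_flux n (($) v) (Suc j) +
    2 * \<kappa> * (if even i then 1 else - 1) * (v $ (2 * j) - v $ Suc (2 * j))"
proof -
  have jn: "j < n" using i j by simp
  have "(\<Sum>l\<le>n. level_diff l i * level_flux n (($) v) l) =
      (\<Sum>l\<le>n. (if l = j then level_flux n (($) v) l else 0) -
        (if l = Suc j then level_flux n (($) v) l else 0))"
    by (intro sum.cong) (auto simp: level_diff_def j level_flux_def level_weight_def)
  also have "\<dots> = level_flux n (($) v) j - level_flux n (($) v) (Suc j)"
    using jn by (simp add: sum_subtractf sum.delta)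
  finally have 1: "(\<Sum>l\<le>n. level_diff l i * level_flux n (($) v) l) =
      level_flux n (($) v) j - level_flux n (($) v) (Suc j)" .
  have "twin_diff j' i = (if j' = j then if even i then 1 else - 1 else 0)" for j'
    using j by (auto simp: twin_diff_def elim!: oddE)
  then have "(\<Sum>j'<n. twin_diff j' i * (\<Sum>i'<2 * n. twin_diff j' i' * v $ i')) =
      (if even i then 1 else - 1) * (v $ (2 * j) - v $ Suc (2 * j))"
    using jn by (simp add: if_distrib[of "\<lambda>x. x * _"] twin_diff_sum cong: if_cong)
  then show ?thesis unfolding ladder_mult_vec[OF v i] 1 by simp
qed

text \<open>Exchanging the sums turns the form into squares with nonnegative weights.\<close>

lemma ladder_quadratic_form:
  assumes v: "v \<in> carrier_vec (2 * n)" and "0 \<le> \<kappa>"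
  shows "0 \<le> scalar_prod v (ladder_matrix n \<kappa> *\<^sub>v v)"
proof -
  have "scalar_prod v (ladder_matrix n \<kappa> *\<^sub>v v) = (\<Sum>i<2 * n. v $ i *
      ((\<Sum>l\<le>n. level_diff l i * level_flux n (($) v) l) +
      2 * \<kappa> * (\<Sum>j<n. twin_diff j i * (\<Sum>i'<2 * n. twin_diff j i' * v $ i'))))"
    using v by (simp add: scalar_prod_def atLeast0LessThan ladder_mult_vec del: index_mult_mat_vec)
  also have "\<dots> = (\<Sum>i<2 * n. \<Sum>l\<le>n. level_diff l i * v $ i * level_flux n (($) v) l) +
      2 * \<kappa> * (\<Sum>i<2 * n. \<Sum>j<n. twin_diff j i * v $ i * (\<Sum>i'<2 * n. twin_diff j i' * v $ i'))"
    by (simp add: distrib_left sum.distrib sum_distrib_left mult_ac)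
  also have "\<dots> = (\<Sum>l\<le>n. (\<Sum>i<2 * n. level_diff l i * v $ i) * level_flux n (($) v) l) +
      2 * \<kappa> * (\<Sum>j<n. (\<Sum>i<2 * n. twin_diff j i * v $ i) * (\<Sum>i'<2 * n. twin_diff j i' * v $ i'))"
    unfolding sum_distrib_right by (subst sum.swap, subst (2) sum.swap) simp
  also have "\<dots> = (\<Sum>l\<le>n. level_weight n l * (\<Sum>i<2 * n. level_diff l i * v $ i)\<^sup>2) +
      2 * \<kappa> * (\<Sum>j<n. (\<Sum>i<2 * n. twin_diff j i * v $ i)\<^sup>2)"
    by (simp add: level_flux_def power2_eq_square mult_ac)
  also have "\<dots> \<ge> 0"
    using assms(2) by (intro add_nonneg_nonneg mult_nonneg_nonneg sum_nonneg)
      (auto simp: level_weight_def)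
  finally show ?thesis .
qed

text \<open>Subtracting the two rows of a level makes twins equal; the flux is then the same on all
  links, hence zero as at the boundary; positive weights finally make adjacent levels equal.\<close>

lemma ladder_kernel:
  assumes "1 \<le> \<kappa>" "0 < n"
  shows "mat_kernel (ladder_matrix n \<kappa>) = {a \<cdot>\<^sub>v Matrix.vec (2 * n) (\<lambda>_. 1) | a. True}"
proof (intro equalityI subsetI)
  fix v assume "v \<in> mat_kernel (ladder_matrix n \<kappa>)"
  then have v: "v \<in> carrier_vec (2 * n)" and Wv: "ladder_matrix n \<kappa> *\<^sub>v v = 0\<^sub>v (2 * n)"
    by (simp_all add: mat_kernel_def)
  define g where "g = level_flux n (($) v)"
  have eq: "g j - g (Suc j) + 2 * \<kappa> * (v $ (2 * j) - v $ Suc (2 * j)) = 0"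
    "g j - g (Suc j) - 2 * \<kappa> * (v $ (2 * j) - v $ Suc (2 * j)) = 0" if "j < n" for j
    using that ladder_mult_vec_eq[OF v, of "2 * j" j \<kappa>] ladder_mult_vec_eq[OF v, of "Suc (2 * j)" j \<kappa>]
    by (simp_all add: Wv g_def)
  have twin: "v $ (2 * j) = v $ Suc (2 * j)" if "j < n" for j
    using eq[OF that] assms(1) by simp
  have g: "g j = 0" if "j \<le> n" for j
    using that
  proof (induction j)
    case (Suc j)
    then show ?case using eq(1)[of j] twin[of j] by simp
  qed (simp add: g_def)
  have level: "v $ (2 * j) = v $ 0" if "j < n" for j
    using that
  proof (induction j)
    case (Suc j)
    then show ?case
      using g[of "Suc j"] level_flux_eq[of "Suc j" n "($) v"] level_weight_pos[of "Suc j" n]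
        twin[of j] twin[of "Suc j"]
      by (auto simp: g_def)
  qed simp
  define a where "a = v $ 0"
  have "v $ i = a" if "i < 2 * n" for i
    using level[of "i div 2"] twin[of "i div 2"] that by (cases "even i") (auto simp: a_def elim!: oddE)
  then have "v = a \<cdot>\<^sub>v Matrix.vec (2 * n) (\<lambda>_. 1)"
    using v by (intro eq_vecI) auto
  then show "v \<in> {a \<cdot>\<^sub>v Matrix.vec (2 * n) (\<lambda>_. 1) | a. True}" by blast
next
  fix v assume "v \<in> {a \<cdot>\<^sub>v Matrix.vec (2 * n) (\<lambda>_. 1 :: real) | a. True}"
  then obtain a where a: "v = a \<cdot>\<^sub>v Matrix.vec (2 * n) (\<lambda>_. 1)" by blast
  then have v: "v \<in> carrier_vec (2 * n)" by simp
  have vi: "v $ i = a" if "i < 2 * n" for i using that by (simp add: a)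
  have g: "level_flux n (($) v) j = 0" if "j \<le> n" for j
  proof (cases "0 < j \<and> j < n")
    case True
    then obtain j' where "j = Suc j'" "Suc j' < n" by (cases j) auto
    then show ?thesis by (simp add: level_flux_eq vi)
  next
    case False
    then have "j = 0 \<or> j = n" using that by auto
    then show ?thesis by auto
  qed
  have "ladder_matrix n \<kappa> *\<^sub>v v = 0\<^sub>v (2 * n)"
  proof (intro eq_vecI)
    fix i assume "i < dim_vec (0\<^sub>v (2 * n) :: real Matrix.vec)"
    then have i: "i < 2 * n" by simp
    then have "i div 2 < n" by simp
    then show "(ladder_matrix n \<kappa> *\<^sub>v v) $ i = 0\<^sub>v (2 * n) $ i"
      using i by (simp add: ladder_mult_vec_eq[OF v i refl] g vi)
  qed simp
  then show "v \<in> mat_kernel (ladder_matrix n \<kappa>)"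
    using v by (simp add: mat_kernel_def)
qed

lemma gossip_matrix_ladder:
  assumes "1 \<le> \<kappa>" "0 < n"
  shows "gossip_matrix (2 * n) (ladder_edges n) (ladder_matrix n \<kappa>)"
proof -
  have "ladder_matrix n \<kappa> $$ (i, i') = 0"
    if "i < 2 * n" "i' < 2 * n" "i \<noteq> i'" "(i, i') \<notin> ladder_edges n" for i i'
  proof -
    \<comment> \<open>Distinct nodes not joined by an edge are at least two levels apart, and no
      rank-one term reaches that far.\<close>
    have "level_diff l i * level_diff l i' = 0" "twin_diff j i * twin_diff j i' = 0" for l j
      using that by (auto simp: ladder_edges_def level_diff_def twin_diff_def)
    then show ?thesis
      using that by (simp add: ladder_matrix_def mult.assoc)
  qed
  moreover have "transpose_mat (ladder_matrix n \<kappa>) = ladder_matrix n \<kappa>"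
    by (intro eq_matI) (auto simp: ladder_matrix_def mult_ac)
  ultimately show ?thesis
    using ladder_quadratic_form[of _ n \<kappa>] ladder_kernel[OF assms] assms
    unfolding gossip_matrix_def by auto
qed

lemma connected_graph_ladder:
  assumes "0 < n"
  shows "connected_graph (2 * n) (ladder_edges n)"
proof -
  have sym: "sym (ladder_edges n)" by (auto simp: ladder_edges_def sym_def)
  have "(0, i) \<in> (ladder_edges n)\<^sup>*" if "i < 2 * n" for i
    using that
  proof (induction i)
    case (Suc i)
    \<comment> \<open>Consecutive numbers lie on the same or on adjacent levels, so they trace a
      Hamiltonian path.\<close>
    then have "(i, Suc i) \<in> ladder_edges n" by (auto simp: ladder_edges_def)
    with Suc show ?case by (meson Suc_lessD rtrancl.rtrancl_into_rtrancl)
  qed simp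
  moreover have "sym ((ladder_edges n)\<^sup>*)" using sym by (rule sym_rtrancl)
  ultimately have "(i, i') \<in> (ladder_edges n)\<^sup>*" if "i < 2 * n" "i' < 2 * n" for i i'
    using that by (meson rtrancl_trans symD)
  with sym assms show ?thesis
    unfolding connected_graph_def by (auto simp: ladder_edges_def irrefl_def)
qed

text \<open>The weights satisfy \<open>w\<^sub>l\<^sub>-\<^sub>1 - 2 w\<^sub>l + w\<^sub>l\<^sub>+\<^sub>1 = - 2\<close>, so \<open>w\<close> is itself a solution of the
  eigenvalue equation of the flux, for the smallest eigenvalue; both bounds follow by evaluating
  the equation where \<open>\<bar>g\<bar> / w\<close> is maximal.\<close>

lemma flux_eigenvalue_bounds:
  fixes g :: "nat \<Rightarrow> real"
  assumes g0: "g 0 = 0" and gn: "g n = 0"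
    and eq: "\<And>l. 0 < l \<Longrightarrow> l < n \<Longrightarrow>
      k * g l = level_weight n l * (2 * (2 * g l - g (l - 1) - g (Suc l)))"
    and nz: "l0 < n" "g l0 \<noteq> 0"
  shows "4 \<le> k \<and> k \<le> 2 * (real n ^ 2 - 2)"
proof -
  define w where "w = level_weight n"
  have l0: "l0 \<in> {1..<n}" using nz g0 by (cases l0) auto
  have "Max ((\<lambda>j. \<bar>g j\<bar> / w j) ` {1..<n}) \<in> (\<lambda>j. \<bar>g j\<bar> / w j) ` {1..<n}"
    using l0 by (intro Max_in) auto
  then obtain l where l: "l \<in> {1..<n}"
    and "\<bar>g l\<bar> / w l = Max ((\<lambda>j. \<bar>g j\<bar> / w j) ` {1..<n})"
    by force
  then have lmax: "\<bar>g j\<bar> / w j \<le> \<bar>g l\<bar> / w l" if "j \<in> {1..<n}" for j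
    using that by simp
  define M where "M = \<bar>g l\<bar> / w l"
  have wl: "0 < w l" using l level_weight_pos by (simp add: w_def)
  have "0 < \<bar>g l0\<bar> / w l0"
    using l0 nz level_weight_pos[of l0 n] by (simp add: w_def)
  then have M: "0 < M" using lmax[OF l0] by (simp add: M_def)
  have gb: "\<bar>g j\<bar> \<le> M * w j" if "j \<le> n" for j
  proof (cases "j \<in> {1..<n}")
    case True
    then show ?thesis
      using lmax[OF True] level_weight_pos[of j n] by (simp add: M_def w_def pos_divide_le_eq)
  next
    case False
    then have "j = 0 \<or> j = n" using that by auto
    then show ?thesis using g0 gn by (auto simp: w_def)
  qed
  \<comment> \<open>Multiplying by this sign makes the extremal entry equal to
    \<open>M * w l\<close>, while all other entries stay within \<open>M * w\<close> in absolute
    value.\<close>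
  define s where "s = sgn (g l)"
  have gl: "s * g l = M * w l"
    using wl by (simp add: M_def s_def sgn_mult_self_eq abs_sgn mult.commute)
  have s: "\<bar>s\<bar> \<le> 1" by (simp add: s_def sgn_real_def)
  have sgb: "\<bar>s * g j\<bar> \<le> M * w j" if "j \<le> n" for j
    using gb[OF that] mult_right_mono[OF s, of "\<bar>g j\<bar>"] by (simp add: abs_mult)
  have "s * (k * g l) = s * (w l * (2 * (2 * g l - g (l - 1) - g (Suc l))))"
    using eq[of l] l by (simp add: w_def)
  then have "k * (s * g l) = w l * (2 * (2 * (s * g l) - s * g (l - 1) - s * g (Suc l)))"
    by (simp add: algebra_simps)
  then have "w l * (k * M) = w l * (2 * (2 * (M * w l) - s * g (l - 1) - s * g (Suc l)))"
    unfolding gl by (simp add: algebra_simps)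
  then have kM: "k * M = 2 * (2 * (M * w l) - s * g (l - 1) - s * g (Suc l))"
    using wl by simp
  have b: "\<bar>s * g (l - 1)\<bar> \<le> M * w (l - 1)" "\<bar>s * g (Suc l)\<bar> \<le> M * w (Suc l)"
    using l by (auto intro: sgb)
  have ws: "w (l - 1) + w (Suc l) = 2 * w l - 2"
    using l by (auto simp: w_def level_weight_def of_nat_diff algebra_simps)
  have "M * w (l - 1) + M * w (Suc l) = M * (2 * w l - 2)"
    using ws by (simp flip: distrib_left)
  \<comment> \<open>The two neighbours together contribute at most \<open>M * (2 * w l - 2)\<close>
    in absolute value; the two extreme signs give the two bounds.\<close>
  with kM b have "4 * M \<le> k * M" "k * M \<le> 2 * (4 * w l - 2) * M"
    by (auto simp: algebra_simps abs_le_iff)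
  with M have "4 \<le> k" "k \<le> 2 * (4 * w l - 2)" by simp_all
  \<comment> \<open>This is the inequality \<open>4 * l * (n - l) <= n^2\<close>, from the square of
    \<open>n - 2 * l\<close>.\<close>
  moreover have "4 * w l \<le> real n ^ 2"
    using zero_le_power2[of "real n - 2 * real l"]
    by (simp add: w_def level_weight_def power2_eq_square algebra_simps)
  ultimately show ?thesis by simp
qed

text \<open>Adding and subtracting the two rows of a level decouples the level sums \<open>V\<close>
  from the twin differences \<open>c\<close>. A nonzero flux satisfies the equation of
  \<open>flux_eigenvalue_bounds\<close>; with zero flux, a nonzero entry of \<open>V\<close> forces
  \<open>k = 0\<close> and one of \<open>c\<close> forces \<open>k = 4 * \<kappa>\<close>.\<close>

lemma ladder_eigenvalue:
  assumes "eigenvalue (ladder_matrix n \<kappa>) k"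
  shows "k = 0 \<or> k = 4 * \<kappa> \<or> 4 \<le> k \<and> k \<le> 2 * (real n ^ 2 - 2)"
proof -
  obtain v where v: "v \<in> carrier_vec (2 * n)" "v \<noteq> 0\<^sub>v (2 * n)"
    and Wv: "ladder_matrix n \<kappa> *\<^sub>v v = k \<cdot>\<^sub>v v"
    using assms by (auto simp: eigenvalue_def eigenvector_def)
  define g where "g = level_flux n (($) v)"
  define V where "V = (\<lambda>j. v $ (2 * j) + v $ Suc (2 * j))"
  define c where "c = (\<lambda>j. v $ (2 * j) - v $ Suc (2 * j))"
  have eq: "g j - g (Suc j) + 2 * \<kappa> * c j = k * v $ (2 * j)"
    "g j - g (Suc j) - 2 * \<kappa> * c j = k * v $ Suc (2 * j)" if "j < n" for j
    using that ladder_mult_vec_eq[OF v(1), of "2 * j" j \<kappa>]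
      ladder_mult_vec_eq[OF v(1), of "Suc (2 * j)" j \<kappa>] v(1)
    by (simp_all add: Wv g_def c_def)
  have kV: "k * V j = 2 * (g j - g (Suc j))" and kc: "k * c j = 4 * \<kappa> * c j" if "j < n" for j
    using eq[OF that] by (simp_all add: V_def c_def algebra_simps)
  show ?thesis
  proof (cases "\<exists>l<n. g l \<noteq> 0")
    case True
    then obtain l0 where l0: "l0 < n" "g l0 \<noteq> 0" by blast
    have "k * g l = level_weight n l * (2 * (2 * g l - g (l - 1) - g (Suc l)))"
      if "0 < l" "l < n" for l
    proof -
      have "g l = level_weight n l * (V l - V (l - 1))"
        using that by (simp add: g_def V_def level_flux_eq algebra_simps)
      then have "k * g l = level_weight n l * (k * V l - k * V (l - 1))"
        by (simp add: right_diff_distrib mult.left_commute)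
      then show ?thesis
        using that kV[of l] kV[of "l - 1"] by simp
    qed
    from flux_eigenvalue_bounds[OF _ _ this l0] show ?thesis by (simp add: g_def)
  next
    case False
    then have g: "g j = 0" if "j \<le> n" for j
      using that by (cases "j = n") (auto simp: g_def)
    show ?thesis
    proof (rule ccontr)
      assume "\<not> ?thesis"
      then have "V j = 0" "c j = 0" if "j < n" for j
        using kV[OF that] kc[OF that] g that by auto
      then have z: "v $ (2 * j) = 0 \<and> v $ Suc (2 * j) = 0" if "j < n" for j
        using that by (fastforce simp: V_def c_def)
      have "v $ i = 0" if "i < 2 * n" for i
        using z[of "i div 2"] that by (cases "even i") auto
      then have "v = 0\<^sub>v (2 * n)" using v(1) by (intro eq_vecI) auto
      with v(2) show False by simp
    qed
  qed
qed

lemma ladder_eigenvalue_four: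
  assumes "2 \<le> n"
  shows "eigenvalue (ladder_matrix n \<kappa>) 4"
proof -
  \<comment> \<open>Linear in the level: level sums jump by \<open>4\<close>, so the flux is
    \<open>4\<close> times the weight, and the differences of consecutive weights reproduce
    \<open>v\<close>.\<close>
  define v where "v = Matrix.vec (2 * n) (\<lambda>i. 2 * real (i div 2) - (real n - 1))"
  have v: "v \<in> carrier_vec (2 * n)" by (simp add: v_def)
  have vi: "v $ i = 2 * real (i div 2) - (real n - 1)" if "i < 2 * n" for i
    using that by (simp add: v_def)
  have g: "level_flux n (($) v) l = 4 * level_weight n l" if "l \<le> n" for l
  proof (cases "0 < l \<and> l < n")
    case True
    then obtain l' where "l = Suc l'" "Suc l' < n" by (cases l) auto
    then show ?thesis by (simp add: level_flux_eq v_def)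
  next
    case False
    then have "l = 0 \<or> l = n" using that by auto
    then show ?thesis by auto
  qed
  have "ladder_matrix n \<kappa> *\<^sub>v v = 4 \<cdot>\<^sub>v v"
  proof (intro eq_vecI)
    fix i assume "i < dim_vec (4 \<cdot>\<^sub>v v)"
    then have i: "i < 2 * n" by (simp add: v_def)
    then have "i div 2 < n" by simp
    then have "(ladder_matrix n \<kappa> *\<^sub>v v) $ i
        = 4 * (level_weight n (i div 2) - level_weight n (Suc (i div 2)))"
      by (simp add: ladder_mult_vec_eq[OF v i refl] g vi)
    also have "\<dots> = 4 * v $ i"
      using i by (simp add: vi level_weight_def algebra_simps)
    finally show "(ladder_matrix n \<kappa> *\<^sub>v v) $ i = (4 \<cdot>\<^sub>v v) $ i" using i v by simp
  qed (simp add: v_def)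
  moreover have "v $ 0 \<noteq> 0" using assms by (simp add: v_def)
  then have "v \<noteq> 0\<^sub>v (2 * n)" using assms by auto
  ultimately show ?thesis
    using v unfolding eigenvalue_def eigenvector_def by auto
qed

lemma ladder_eigenvalue_max:
  assumes "0 < n"
  shows "eigenvalue (ladder_matrix n \<kappa>) (4 * \<kappa>)"
proof -
  \<comment> \<open>Opposite values on one pair of twins have zero level sums, hence no flux, and
    only the twin term acts.\<close>
  define v where "v = Matrix.vec (2 * n) (twin_diff 0)"
  have v: "v \<in> carrier_vec (2 * n)" by (simp add: v_def)
  have V: "v $ (2 * j) + v $ Suc (2 * j) = 0" if "j < n" for j
    using that by (simp add: v_def twin_diff_def)
  have g: "level_flux n (($) v) l = 0" if "l \<le> n" for l
  proof (cases "0 < l \<and> l < n")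
    case True
    then obtain l' where "l = Suc l'" "Suc l' < n" by (cases l) auto
    then show ?thesis using V[of l] V[of l'] by (simp add: level_flux_eq)
  next
    case False
    then have "l = 0 \<or> l = n" using that by auto
    then show ?thesis by auto
  qed
  have "ladder_matrix n \<kappa> *\<^sub>v v = (4 * \<kappa>) \<cdot>\<^sub>v v"
  proof (intro eq_vecI)
    fix i assume "i < dim_vec ((4 * \<kappa>) \<cdot>\<^sub>v v)"
    then have i: "i < 2 * n" by (simp add: v_def)
    then have "i div 2 < n" by simp
    then have "(ladder_matrix n \<kappa> *\<^sub>v v) $ i = 2 * \<kappa> * (if even i then 1 else - 1) *
        (v $ (2 * (i div 2)) - v $ Suc (2 * (i div 2)))"
      by (simp add: ladder_mult_vec_eq[OF v i refl] g)
    also have "\<dots> = 4 * \<kappa> * v $ i"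
      using i by (auto simp: v_def twin_diff_def)
    finally show "(ladder_matrix n \<kappa> *\<^sub>v v) $ i = ((4 * \<kappa>) \<cdot>\<^sub>v v) $ i" using i v by simp
  qed (simp add: v_def)
  moreover have "v $ 0 \<noteq> 0" using assms by (simp add: v_def twin_diff_def)
  then have "v \<noteq> 0\<^sub>v (2 * n)" using assms by auto
  ultimately show ?thesis
    using v unfolding eigenvalue_def eigenvector_def by auto
qed

text \<open>The third hypothesis puts the upper bound on the flux eigenvalues below the twin
  eigenvalue \<open>4 * \<kappa>\<close>, so the extreme positive eigenvalues are \<open>4\<close>
  and \<open>4 * \<kappa>\<close>.\<close>

lemma chi_ladder:
  assumes "1 \<le> \<kappa>" "2 \<le> n" "real n ^ 2 - 2 \<le> 2 * \<kappa>"
  shows "chi (ladder_matrix n \<kappa>) = \<kappa>"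
proof -
  let ?W = "ladder_matrix n \<kappa>"
  \<comment> \<open>The spectrum must be finite for \<open>Max\<close> and \<open>Min\<close> in
    \<open>chi\<close> to be meaningful.\<close>
  have "char_poly ?W \<noteq> 0"
    using degree_monic_char_poly[of ?W "2 * n"] by force
  then have "finite {k. poly (char_poly ?W) k = 0}" by (rule poly_roots_finite)
  then have fin: "finite {k. eigenvalue ?W k}"
    using eigenvalue_root_char_poly[of ?W "2 * n"] by simp
  have "Max {k. eigenvalue ?W k} = 4 * \<kappa>"
    using fin assms ladder_eigenvalue[of n \<kappa>] ladder_eigenvalue_max[of n \<kappa>]
    by (intro Max_eqI) fastforce+
  moreover have "Min {k. eigenvalue ?W k \<and> 0 < k} = 4"
    using fin assms ladder_eigenvalue[of n \<kappa>] ladder_eigenvalue_four[of n \<kappa>]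
    by (intro Min_eqI) (auto intro: finite_subset, fastforce)
  ultimately show ?thesis by (simp add: chi_def)
qed

subsection \<open>A bilinear chain split between two nodes\<close>

definition shift_up :: "nat \<Rightarrow> rvec \<Rightarrow> rvec"
  where "shift_up N x = (\<Sum>k<N - 1. Poly_Mapping.lookup x k *\<^sub>R basis_vec (Suc k))"

definition shift_down :: "nat \<Rightarrow> rvec \<Rightarrow> rvec"
  where "shift_down N y = (\<Sum>k<N - 1. Poly_Mapping.lookup y (Suc k) *\<^sub>R basis_vec k)"

lemma lookup_shift_up:
  "Poly_Mapping.lookup (shift_up N x) k = (if 0 < k \<and> k < N then Poly_Mapping.lookup x (k - 1) else 0)"
proof (cases k)
  case (Suc k')
  have "Poly_Mapping.lookup (shift_up N x) k =
      (\<Sum>l<N - 1. if l = k' then Poly_Mapping.lookup x l else 0)"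
    unfolding shift_up_def lookup_sum by (intro sum.cong) (auto simp: Suc)
  then show ?thesis by (auto simp: sum.delta Suc)
qed (simp add: shift_up_def lookup_sum)

lemma lookup_shift_down:
  "Poly_Mapping.lookup (shift_down N y) k = (if Suc k < N then Poly_Mapping.lookup y (Suc k) else 0)"
proof -
  have "Poly_Mapping.lookup (shift_down N y) k =
      (\<Sum>l<N - 1. if l = k then Poly_Mapping.lookup y (Suc l) else 0)"
    unfolding shift_down_def lookup_sum by (intro sum.cong) auto
  then show ?thesis by (auto simp: sum.delta)
qed

lemma shift_adjoint: "y \<bullet> shift_up N x = shift_down N y \<bullet> x"
  by (simp add: shift_up_def shift_down_def inner_sum_left inner_sum_right
      inner_commute[of "basis_vec _" x] mult.commute)

lemma shift_in_Rn: "shift_up N x \<in> Rn N" "shift_down N x \<in> Rn N"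
  by (auto simp: Rn_iff lookup_shift_up lookup_shift_down)

lemma shift_diff:
  "shift_up N (x - x') = shift_up N x - shift_up N x'"
  "shift_down N (x - x') = shift_down N x - shift_down N x'"
  by (auto intro!: poly_mapping_eqI simp: lookup_shift_up lookup_shift_down lookup_minus)

lemma norm_shift_up: assumes "x \<in> Rn N" shows "norm (shift_up N x) \<le> norm x"
proof (cases N)
  case (Suc M)
  have "(norm (shift_up N x))\<^sup>2 = (\<Sum>k<M. (Poly_Mapping.lookup x k)\<^sup>2)"
    unfolding norm_Rn[OF shift_in_Rn(1)] Suc sum.lessThan_Suc_shift by (simp add: lookup_shift_up)
  also have "\<dots> \<le> (norm x)\<^sup>2"
    by (simp add: norm_Rn[OF assms] Suc)
  finally have "(norm (shift_up N x))\<^sup>2 \<le> (norm x)\<^sup>2" .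
  then show ?thesis by (rule power2_le_imp_le) simp
qed (simp add: shift_up_def)

text \<open>The adjoint of a contraction is a contraction.\<close>

lemma norm_shift_down: assumes "y \<in> Rn N" shows "norm (shift_down N y) \<le> norm y"
proof -
  have "(norm (shift_down N y))\<^sup>2 = y \<bullet> shift_up N (shift_down N y)"
    by (simp add: power2_norm_eq_inner shift_adjoint)
  also have "\<dots> \<le> norm y * norm (shift_up N (shift_down N y))"
    by (rule norm_cauchy_schwarz)
  also have "\<dots> \<le> norm y * norm (shift_down N y)"
    by (intro mult_left_mono norm_shift_up shift_in_Rn) auto
  finally show ?thesis
    by (cases "norm (shift_down N y) = 0") (auto simp: power2_eq_square mult_le_cancel_right)
qed

text \<open>Up to the factor \<open>\<mu>\<close>, the gradient in \<open>y\<close> of the average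
  objective.\<close>

definition residual :: "nat \<Rightarrow> real \<Rightarrow> rvec \<Rightarrow> rvec"
  where "residual N \<beta> x = x - shift_up N x - \<beta> *\<^sub>R basis_vec 0"

lemma residual_in_Rn: "0 < N \<Longrightarrow> x \<in> Rn N \<Longrightarrow> residual N \<beta> x \<in> Rn N"
  using shift_in_Rn(1)[of N x]
  by (auto simp: residual_def Rn_iff lookup_minus)

lemma inner_residual:
  "y \<bullet> residual N \<beta> x = (y - shift_down N y) \<bullet> x - \<beta> * Poly_Mapping.lookup y 0"
  by (simp add: residual_def inner_diff_left inner_diff_right shift_adjoint)

definition ones :: "nat \<Rightarrow> rvec"
  where "ones N = (\<Sum>k<N. basis_vec k)"

lemma lookup_ones: "Poly_Mapping.lookup (ones N) k = (if k < N then 1 else 0)"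
proof -
  have "Poly_Mapping.lookup (ones N) k = (\<Sum>l<N. if l = k then 1 else 0)"
    unfolding ones_def lookup_sum by (intro sum.cong) auto
  then show ?thesis by (simp add: sum.delta)
qed

lemma ones_in_Rn: "ones N \<in> Rn N"
  by (simp add: Rn_iff lookup_ones)

lemma norm_ones: "norm (ones N) = sqrt (real N)"
proof -
  have "(norm (ones N))\<^sup>2 = real N"
    by (simp add: norm_Rn[OF ones_in_Rn] lookup_ones)
  then show ?thesis by (metis norm_ge_zero real_sqrt_unique)
qed

lemma residual_ones: assumes "0 < N" shows "residual N \<beta> (\<beta> *\<^sub>R ones N) = 0"
  using assms
  by (intro poly_mapping_eqI)
    (auto simp: residual_def lookup_minus lookup_ones lookup_shift_up)

text \<open>The coordinates of the residual telescope to \<open>x\<^sub>N\<^sub>-\<^sub>1 - \<beta>\<close>.\<close>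

lemma norm_residual_ge:
  assumes "0 < N" "x \<in> Rn (N - 1)" "0 \<le> \<beta>"
  shows "\<beta> \<le> norm (residual N \<beta> x) * sqrt (real N)"
proof -
  have "(\<Sum>k<Suc M. Poly_Mapping.lookup (residual N \<beta> x) k) = Poly_Mapping.lookup x M - \<beta>"
    if "M < N" for M
    using that
    by (induction M)
      (auto simp: residual_def lookup_minus lookup_shift_up)
  from this[of "N - 1"] have "(\<Sum>k<N. Poly_Mapping.lookup (residual N \<beta> x) k) = - \<beta>"
    using assms by (simp add: Rn_iff)
  moreover have "residual N \<beta> x \<bullet> ones N = (\<Sum>k<N. Poly_Mapping.lookup (residual N \<beta> x) k)"
    by (simp add: ones_def inner_sum_right)
  ultimately show ?thesis
    using Cauchy_Schwarz_ineq2[of "residual N \<beta> x" "ones N"] assms(3) by (simp add: norm_ones)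
qed

section \<open>The saddle point problem and its regularity\<close>

text \<open>Every objective here is affine in each block separately, so all gradients are read off
  from this rule.\<close>

lemma grad_affine:
  assumes "g \<in> Rn d" "u \<in> Rn d" "\<And>v. \<phi> v = g \<bullet> v + a"
  shows "grad d \<phi> u = g"
proof -
  have "\<phi> = (\<lambda>v. g \<bullet> v + a)" using assms(3) by blast
  then have "(\<phi> has_derivative (\<lambda>h. g \<bullet> h)) (at u within Rn d)"
    by (auto intro!: derivative_eq_intros)
  with assms show ?thesis by (intro grad_eqI)
qed

definition chain_fun :: "nat \<Rightarrow> nat \<Rightarrow> real \<Rightarrow> real \<Rightarrow> nat \<Rightarrow> rvec \<Rightarrow> rvec \<Rightarrow> real"
  where "chain_fun n N c \<beta> i x y =
    (if i = 0 then c * (y \<bullet> x)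
     else if i = 2 * n - 1 then - c * (y \<bullet> shift_up N x + \<beta> * Poly_Mapping.lookup y 0)
     else 0)"

text \<open>The factor \<open>2 * real n * \<mu>\<close> cancels the averaging over
  \<open>2 * n\<close> nodes. The local blocks are void, that is \<open>{0}\<close> in dimension
  \<open>0\<close>.\<close>

definition chain_problem :: "nat \<Rightarrow> nat \<Rightarrow> real \<Rightarrow> real \<Rightarrow> real \<Rightarrow> saddle_problem"
  where "chain_problem n N r \<mu> \<beta> =
    \<lparr>nodes = 2 * n, dim_x = N, dim_p = (\<lambda>_. 0), dim_y = N, dim_q = (\<lambda>_. 0),
     set_x = Rn_ball N r, set_p = (\<lambda>_. {0}), set_y = Rn_ball N r, set_q = (\<lambda>_. {0}),
     node_fun = (\<lambda>i x p y q. chain_fun n N (2 * real n * \<mu>) \<beta> i x y)\<rparr>"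

lemma chain_problem_simps [simp]:
  "nodes (chain_problem n N r \<mu> \<beta>) = 2 * n"
  "dim_x (chain_problem n N r \<mu> \<beta>) = N" "dim_y (chain_problem n N r \<mu> \<beta>) = N"
  "dim_p (chain_problem n N r \<mu> \<beta>) i = 0" "dim_q (chain_problem n N r \<mu> \<beta>) i = 0"
  "set_x (chain_problem n N r \<mu> \<beta>) = Rn_ball N r" "set_y (chain_problem n N r \<mu> \<beta>) = Rn_ball N r"
  "set_p (chain_problem n N r \<mu> \<beta>) i = {0}" "set_q (chain_problem n N r \<mu> \<beta>) i = {0}"
  "node_fun (chain_problem n N r \<mu> \<beta>) i x p y q = chain_fun n N (2 * real n * \<mu>) \<beta> i x y"
  by (simp_all add: chain_problem_def)

lemma grad_chain_fun_x:
  assumes "x \<in> Rn N" "y \<in> Rn N"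
  shows "grad N (\<lambda>u. chain_fun n N c \<beta> i u y) x =
    (if i = 0 then c *\<^sub>R y else if i = 2 * n - 1 then - c *\<^sub>R shift_down N y else 0)"
  by (rule grad_affine[where a = "if i = 0 then 0 else if i = 2 * n - 1
        then - c * (\<beta> * Poly_Mapping.lookup y 0) else 0"])
    (use assms shift_in_Rn(2)[of N y] in
      \<open>auto simp: chain_fun_def Rn_iff shift_adjoint algebra_simps\<close>)

lemma grad_chain_fun_y:
  assumes "x \<in> Rn N" "y \<in> Rn N" "0 < N"
  shows "grad N (\<lambda>u. chain_fun n N c \<beta> i x u) y =
    (if i = 0 then c *\<^sub>R x else if i = 2 * n - 1
     then - c *\<^sub>R (shift_up N x + \<beta> *\<^sub>R basis_vec 0) else 0)"
  by (rule grad_affine[where a = 0])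
    (use assms shift_in_Rn(1)[of N x] in
      \<open>auto simp: chain_fun_def Rn_iff lookup_add lookup_minus inner_add_left
        inner_add_right inner_commute[of _ "shift_up N x"] inner_commute[of x]
        inner_commute[of "basis_vec 0"] algebra_simps\<close>)

lemma avg_fun_chain:
  assumes "0 < n"
  shows "avg_fun (chain_problem n N r \<mu> \<beta>) x p y q = \<mu> * (y \<bullet> residual N \<beta> x)"
proof -
  \<comment> \<open>With at least two nodes, node \<open>0\<close> and the last node are distinct,
    so both pieces of the chain occur in the sum.\<close>
  obtain M where M: "2 * n = Suc (Suc M)" using assms by (cases n) auto
  have "(\<Sum>i<2 * n. chain_fun n N (2 * real n * \<mu>) \<beta> i x y) =
      (\<Sum>i\<in>{0, Suc M}. chain_fun n N (2 * real n * \<mu>) \<beta> i x y)"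
    by (rule sum.mono_neutral_right) (auto simp: M chain_fun_def)
  also have "\<dots> = 2 * real n * \<mu> * (y \<bullet> x) -
      2 * real n * \<mu> * (y \<bullet> shift_up N x + \<beta> * Poly_Mapping.lookup y 0)"
    by (simp add: chain_fun_def M)
  also have "\<dots> = 2 * real n * (\<mu> * (y \<bullet> residual N \<beta> x))"
    by (simp add: residual_def inner_diff_right algebra_simps)
  finally show ?thesis using assms by (simp add: avg_fun_def)
qed

lemma admissible_chain:
  assumes "0 < N" "0 < R"
  shows "admissible_sets (chain_problem n N (sqrt 2 * R) \<mu> \<beta>) R"
proof -
  have "Rn_ball N r \<subseteq> Rn N" for r by (auto simp: Rn_ball_def)
  then show ?thesis
    using assms subspace_0[OF subspace_Rn]
    by (simp add: admissible_sets_def convex_Rn_ball compact_Rn_ball has_size_Rn_ball)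
qed

lemma differentiable_chain: "differentiable_nodes (chain_problem n N r \<mu> \<beta>)"
proof -
  have 1: "(\<lambda>(x, p, y, q). c * (y \<bullet> x)) differentiable (at z within S)"
    for c and z :: "rvec \<times> rvec \<times> rvec \<times> rvec" and S
    unfolding differentiable_def split_def by (rule exI) (rule derivative_eq_intros refl)+
  \<comment> \<open>The shift is expanded into products of inner products with basis vectors, to
    which the derivative rules apply directly.\<close>
  have 2: "(\<lambda>(x, p, y, q). c * ((\<Sum>k<N - 1. (x \<bullet> basis_vec k) * (y \<bullet> basis_vec (Suc k))) +
      \<beta> * (y \<bullet> basis_vec 0))) differentiable (at z within S)"
    for c and z :: "rvec \<times> rvec \<times> rvec \<times> rvec" and S
    unfolding differentiable_def split_def by (rule exI) (rule derivative_eq_intros refl)+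
  have 3: "(\<lambda>(x, p, y, q). 0 :: real) differentiable (at z within S)"
    for z :: "rvec \<times> rvec \<times> rvec \<times> rvec" and S
    by (simp add: split_def)
  have sh: "y \<bullet> shift_up N x = (\<Sum>k<N - 1. (x \<bullet> basis_vec k) * (y \<bullet> basis_vec (Suc k)))" for x y
    by (simp add: shift_up_def inner_sum_right)
  have "(\<lambda>(x, p, y, q). chain_fun n N c \<beta> i x y) differentiable (at z within S)"
    for c i and z :: "rvec \<times> rvec \<times> rvec \<times> rvec" and S
    unfolding chain_fun_def sh inner_basis_vec[symmetric]
    by (cases "i = 0"; cases "i = 2 * n - 1") (simp_all only: if_True if_False simp_thms 1 2 3)
  then show ?thesis
    by (simp add: differentiable_nodes_def differentiable_on_def)
qed

lemma convex_concave_chain: "convex_concave (chain_problem n N r \<mu> \<beta>)"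
proof -
  \<comment> \<open>In \<open>x\<close> the function is affine only, because of the source term,
    hence the condition \<open>u + v = 1\<close>; in \<open>y\<close> it is linear.\<close>
  have x: "chain_fun n N c \<beta> i (u *\<^sub>R x + v *\<^sub>R x') y =
      u * chain_fun n N c \<beta> i x y + v * chain_fun n N c \<beta> i x' y" if "u + v = 1" for c i u v x x' y
  proof -
    have v: "v = 1 - u" using that by simp
    show ?thesis
      unfolding chain_fun_def shift_adjoint v by (simp add: inner_add_right algebra_simps)
  qed
  have y: "chain_fun n N c \<beta> i x (u *\<^sub>R y + v *\<^sub>R y') =
      u * chain_fun n N c \<beta> i x y + v * chain_fun n N c \<beta> i x y'" for c i u v x y y'
    by (simp add: chain_fun_def inner_add_left lookup_add algebra_simps)
  show ?thesis
    unfolding convex_concave_def convex_on_def concave_on_iff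
    by (auto simp: x y intro!: convex_Times convex_Rn_ball)
qed

text \<open>The source cancels in gradient differences, which are \<open>\<mu>\<close> times the
  identity minus a shift; as shifts are contractions, this operator has norm at most
  \<open>2 * \<mu>\<close>.\<close>

lemma avg_smooth_chain:
  assumes "0 < n" "0 < N" "0 < \<mu>"
  shows "avg_smooth (chain_problem n N r \<mu> \<beta>) (2 * \<mu>)"
proof -
  let ?A = "chain_problem n N r \<mu> \<beta>"
  have gx: "grad_x ?A x p y q = \<mu> *\<^sub>R (y - shift_down N y)"
    if "x \<in> Rn_ball N r" "y \<in> Rn_ball N r" for x p y q
    unfolding grad_x_def using that shift_in_Rn(2)[of N y]
    by (intro grad_affine[where a = "- \<mu> * \<beta> * Poly_Mapping.lookup y 0"])
      (auto simp: avg_fun_chain[OF assms(1)] inner_residual Rn_ball_def Rn_iff lookup_minus algebra_simps)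
  have gy: "grad_y ?A x p y q = \<mu> *\<^sub>R residual N \<beta> x"
    if "x \<in> Rn_ball N r" "y \<in> Rn_ball N r" for x p y q
    unfolding grad_y_def using that residual_in_Rn[OF assms(2), of x \<beta>]
    by (intro grad_affine[where a = 0])
      (auto simp: avg_fun_chain[OF assms(1)] Rn_ball_def Rn_iff inner_commute)
  have gp: "grad_p ?A x p y q i = 0" if "p \<in> prod_p ?A" "i < 2 * n" for x p y q i
    unfolding grad_p_def using that
    by (intro grad_affine[where a = "avg_fun ?A x p y q"])
      (auto simp: avg_fun_chain[OF assms(1)] prod_p_def PiE_iff Rn_iff)
  have gq: "grad_q ?A x p y q i = 0" if "q \<in> prod_q ?A" "i < 2 * n" for x p y q i
    unfolding grad_q_def using that
    by (intro grad_affine[where a = "avg_fun ?A x p y q"])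
      (auto simp: avg_fun_chain[OF assms(1)] prod_q_def PiE_iff Rn_iff)
  have p0: "p i - p' i = 0" if "p \<in> prod_p ?A" "p' \<in> prod_p ?A" "i < 2 * n" for p p' i
    using that by (auto simp: prod_p_def PiE_iff)
  have q0: "q i - q' i = 0" if "q \<in> prod_q ?A" "q' \<in> prod_q ?A" "i < 2 * n" for q q' i
    using that by (auto simp: prod_q_def PiE_iff)
  have sq: "(norm (\<mu> *\<^sub>R (z - w)))\<^sup>2 \<le> (2 * \<mu>)\<^sup>2 * (norm z)\<^sup>2" if "norm w \<le> norm z" for z w :: rvec
  proof -
    have "norm (z - w) \<le> 2 * norm z" using that norm_triangle_ineq4[of z w] by linarith
    then have "norm (\<mu> *\<^sub>R (z - w)) \<le> 2 * \<mu> * norm z" using assms(3) by simp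
    then show ?thesis by (metis norm_ge_zero power_mono power_mult_distrib)
  qed
  show ?thesis
    unfolding avg_smooth_def
  proof (intro ballI)
    fix x p y q x' p' y' q'
    assume H: "x \<in> set_x ?A" "p \<in> prod_p ?A" "y \<in> set_y ?A" "q \<in> prod_q ?A"
      "x' \<in> set_x ?A" "p' \<in> prod_p ?A" "y' \<in> set_y ?A" "q' \<in> prod_q ?A"
    then have R: "x - x' \<in> Rn N" "y - y' \<in> Rn N"
      by (auto simp: Rn_ball_def intro: subspace_diff[OF subspace_Rn])
    have dx: "grad_x ?A x p y q - grad_x ?A x' p' y' q' = \<mu> *\<^sub>R ((y - y') - shift_down N (y - y'))"
      using H by (simp add: gx shift_diff algebra_simps)
    have dy: "grad_y ?A x p y q - grad_y ?A x' p' y' q' = \<mu> *\<^sub>R ((x - x') - shift_up N (x - x'))"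
      using H by (simp add: gy residual_def shift_diff algebra_simps)
    have "block_norm (nodes ?A) (grad_x ?A x p y q - grad_x ?A x' p' y' q')
        (\<lambda>i. grad_p ?A x p y q i - grad_p ?A x' p' y' q' i)
        (grad_y ?A x p y q - grad_y ?A x' p' y' q')
        (\<lambda>i. grad_q ?A x p y q i - grad_q ?A x' p' y' q' i)
      = sqrt ((norm (\<mu> *\<^sub>R ((y - y') - shift_down N (y - y'))))\<^sup>2 +
          (norm (\<mu> *\<^sub>R ((x - x') - shift_up N (x - x'))))\<^sup>2)"
      using H by (simp add: block_norm_def dx dy gp gq)
    also have "\<dots> \<le> sqrt ((2 * \<mu>)\<^sup>2 * ((norm (x - x'))\<^sup>2 + (norm (y - y'))\<^sup>2))"
      using add_mono[OF sq[OF norm_shift_down[OF R(2)]] sq[OF norm_shift_up[OF R(1)]]]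
      by (intro real_sqrt_le_mono) (simp only: distrib_left add.commute)
    also have "\<dots> = 2 * \<mu> * sqrt ((norm (x - x'))\<^sup>2 + (norm (y - y'))\<^sup>2)"
      using assms(3) by (simp add: real_sqrt_mult)
    also have "\<dots> = 2 * \<mu> * block_norm (nodes ?A) (x - x') (\<lambda>i. p i - p' i) (y - y') (\<lambda>i. q i - q' i)"
      using H by (simp add: block_norm_def p0 q0)
    finally show "block_norm (nodes ?A) (grad_x ?A x p y q - grad_x ?A x' p' y' q')
        (\<lambda>i. grad_p ?A x p y q i - grad_p ?A x' p' y' q' i)
        (grad_y ?A x p y q - grad_y ?A x' p' y' q')
        (\<lambda>i. grad_q ?A x p y q i - grad_q ?A x' p' y' q' i)
      \<le> 2 * \<mu> * block_norm (nodes ?A) (x - x') (\<lambda>i. p i - p' i) (y - y') (\<lambda>i. q i - q' i)" .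
  qed
qed

text \<open>The maximum is tested with \<open>y\<close> on the sphere in the direction of the
  residual, the minimum with the multiple of \<open>ones N\<close> that annihilates the residual.
  The bound on \<open>\<beta>\<close> keeps the latter point in the ball, and nothing is asked of
  the output \<open>y\<close>.\<close>

lemma saddle_gap_chain_ge:
  assumes "0 < n" "0 < N" "0 < \<mu>" "0 < r" "0 \<le> \<beta>" "\<beta> * sqrt (real N) \<le> r"
    and x: "x \<in> Rn N" "residual N \<beta> x \<noteq> 0"
  shows "\<mu> * (r * norm (residual N \<beta> x)) \<le> saddle_gap (chain_problem n N r \<mu> \<beta>) x p y q"
proof -
  let ?A = "chain_problem n N r \<mu> \<beta>" and ?G = "residual N \<beta> x"
  define o0 where "o0 = (\<lambda>i\<in>{..<2 * n}. 0 :: rvec)"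
  have o0: "o0 \<in> prod_p ?A" "o0 \<in> prod_q ?A"
    by (simp_all add: o0_def prod_p_def prod_q_def)
  have "\<mu> * (r * norm ?G) = avg_fun ?A x p ((r / norm ?G) *\<^sub>R ?G) o0"
    using x(2) by (simp add: avg_fun_chain[OF assms(1)] flip: power2_norm_eq_inner)
      (simp add: power2_eq_square)
  also have "\<dots> \<le> (SUP (y', q') \<in> set_y ?A \<times> prod_q ?A. avg_fun ?A x p y' q')"
  proof (rule cSUP_upper2[where x = "((r / norm ?G) *\<^sub>R ?G, o0)"])
    show "((r / norm ?G) *\<^sub>R ?G, o0) \<in> set_y ?A \<times> prod_q ?A"
      using o0 residual_in_Rn[OF assms(2) x(1), of \<beta>] assms(4)
      by (auto simp: Rn_ball_def Rn_iff)
    \<comment> \<open>A real supremum, and likewise the infimum below, can be compared with a value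
      only once boundedness is known.\<close>
    show "bdd_above ((\<lambda>(y', q'). avg_fun ?A x p y' q') ` (set_y ?A \<times> prod_q ?A))"
    proof (rule bdd_aboveI2, clarify)
      fix y' q' assume "y' \<in> set_y ?A"
      then have "y' \<bullet> ?G \<le> r * norm ?G"
        using norm_cauchy_schwarz[of y' ?G] mult_right_mono[of "norm y'" r "norm ?G"]
        by (auto simp: Rn_ball_def)
      then show "avg_fun ?A x p y' q' \<le> \<mu> * (r * norm ?G)"
        using assms(3) by (simp add: avg_fun_chain[OF assms(1)])
    qed
  qed auto
  finally have S: "\<mu> * (r * norm ?G) \<le>
    (SUP (y', q') \<in> set_y ?A \<times> prod_q ?A. avg_fun ?A x p y' q')" .
  let ?x = "\<beta> *\<^sub>R ones N" and ?h = "y - shift_down N y"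
  have "(INF (x', p') \<in> set_x ?A \<times> prod_p ?A. avg_fun ?A x' p' y q) \<le> avg_fun ?A ?x o0 y q"
  proof (rule cINF_lower2[where x = "(?x, o0)"])
    show "(?x, o0) \<in> set_x ?A \<times> prod_p ?A"
      using o0 ones_in_Rn[of N] assms(5,6)
      by (auto simp: Rn_ball_def Rn_iff norm_ones)
    show "bdd_below ((\<lambda>(x', p'). avg_fun ?A x' p' y q) ` (set_x ?A \<times> prod_p ?A))"
    proof (rule bdd_belowI2, clarify)
      fix x' p' assume "x' \<in> set_x ?A"
      then have "- (r * norm ?h) \<le> ?h \<bullet> x'"
        using Cauchy_Schwarz_ineq2[of ?h x'] mult_left_mono[of "norm x'" r "norm ?h"]
        by (auto simp: Rn_ball_def mult.commute)
      then show "\<mu> * (- (r * norm ?h) - \<beta> * Poly_Mapping.lookup y 0) \<le> avg_fun ?A x' p' y q"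
        using assms(3) by (simp add: avg_fun_chain[OF assms(1)] inner_residual)
    qed
  qed auto
  also have "\<dots> = 0" by (simp add: avg_fun_chain[OF assms(1)] residual_ones[OF assms(2)])
  finally show ?thesis using S by (simp add: saddle_gap_def)
qed

section \<open>Coordinate supports under a single step\<close>

text \<open>Vectors supported in a given set of coordinates form a subspace, and projection onto a
  centred ball creates no new coordinates. So a mirror step can only combine the supports of the
  memory and of the gradients.\<close>

lemma local_set_subset:
  assumes "0 \<le> r"
    and "t \<le> s \<Longrightarrow> U \<subseteq> {v. \<forall>k\<in>Poly_Mapping.keys v. P k}"
    and "t \<le> s \<Longrightarrow> G \<subseteq> {v. \<forall>k\<in>Poly_Mapping.keys v. P k}"
  shows "local_set t s (Rn_ball d r) G U \<subseteq> {v. \<forall>k\<in>Poly_Mapping.keys v. P k}"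
proof (cases "s < t")
  case False
  let ?V = "{v :: rvec. \<forall>k\<in>Poly_Mapping.keys v. P k}"
  have "Mirr (\<gamma> *\<^sub>R g) u (Rn_ball d r) \<in> ?V" if "u \<in> U" "g \<in> G" for u g \<gamma>
  proof -
    have "u - \<gamma> *\<^sub>R g \<in> ?V"
      using that assms(2,3) False
      by (intro subspace_diff[OF subspace_keys] subspace_scale[OF subspace_keys]) auto
    then show ?thesis
      using keys_proj_Rn_ball[OF assms(1), of d "u - \<gamma> *\<^sub>R g"] by (auto simp: Mirr_def)
  qed
  then have "span (\<Union>u\<in>U. \<Union>g\<in>G. \<Union>\<gamma>. {u, g, Mirr (\<gamma> *\<^sub>R g) u (Rn_ball d r)}) \<subseteq> ?V"
    using assms(2,3) False by (intro span_minimal subspace_keys) auto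
  with False show ?thesis by (simp add: local_set_def)
qed (simp add: local_set_def)

lemma comm_set_subset:
  assumes "\<And>j. \<tau> \<le> s \<Longrightarrow> (j, i) \<in> E \<Longrightarrow> H j (s - \<tau>) \<subseteq> {v. \<forall>k\<in>Poly_Mapping.keys v. P k}"
  shows "comm_set E \<tau> H i s \<subseteq> {v. \<forall>k\<in>Poly_Mapping.keys v. P k}"
proof (cases "s < \<tau>")
  case False
  then have "span (\<Union>j\<in>{j. (j, i) \<in> E}. H j (s - \<tau>)) \<subseteq> {v. \<forall>k\<in>Poly_Mapping.keys v. P k}"
    using assms by (intro span_minimal subspace_keys) auto
  with False show ?thesis by (simp add: comm_set_def)
qed (simp add: comm_set_def)

subsection \<open>Propagation of the coordinates\<close>

text \<open>The earliest times at which coordinate \<open>k\<close> can be known on level \<open>j\<close>, where \<open>D\<close> is the last level: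
  coordinates of \<open>x\<close> are created on level \<open>0\<close> and coordinates of \<open>y\<close> on level \<open>D\<close>.\<close>

definition arrival_x :: "real \<Rightarrow> real \<Rightarrow> real \<Rightarrow> nat \<Rightarrow> real \<Rightarrow> real"
  where "arrival_x t \<tau> D k j = (2 * real k + 2) * t + ((2 * real k + 1) * D + j) * \<tau>"

definition arrival_y :: "real \<Rightarrow> real \<Rightarrow> real \<Rightarrow> nat \<Rightarrow> real \<Rightarrow> real"
  where "arrival_y t \<tau> D k j = (2 * real k + 1) * t + (2 * real k * D + (D - j)) * \<tau>"

text \<open>The three ways of creating a coordinate: \<open>x\<close> copies \<open>y\<close> on
  level \<open>0\<close>, the next \<open>y\<close> copies \<open>x\<close> on level
  \<open>D\<close>, and the source starts the chain after one local step.\<close>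

lemma arrival_local:
  "arrival_x t \<tau> D k 0 = arrival_y t \<tau> D k 0 + t"
  "arrival_y t \<tau> D (Suc k) D = arrival_x t \<tau> D k D + t"
  "arrival_y t \<tau> D 0 D = t"
  by (simp_all add: arrival_x_def arrival_y_def algebra_simps)

text \<open>Coordinates of \<open>x\<close> travel upwards from level \<open>0\<close> and those of
  \<open>y\<close> downwards from level \<open>D\<close>, so arrival times change by
  \<open>\<tau>\<close> per level and one side of adjacency suffices for each.\<close>

lemma arrival_comm:
  assumes "0 < \<tau>"
  shows "j \<le> j' + 1 \<Longrightarrow> arrival_x t \<tau> D k j \<le> arrival_x t \<tau> D k j' + \<tau>"
    and "j' \<le> j + 1 \<Longrightarrow> arrival_y t \<tau> D k j \<le> arrival_y t \<tau> D k j' + \<tau>"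
  using assms mult_right_mono[of j "j' + 1" \<tau>] mult_right_mono[of j' "j + 1" \<tau>]
  by (simp_all add: arrival_x_def arrival_y_def algebra_simps)

text \<open>Time is continuous, so the induction runs over slabs of length
  \<open>min t \<tau>\<close>: any step completed in one slab started in an earlier one.\<close>

lemma black_box_progress:
  assumes bb: "black_box (chain_problem n N r \<mu> \<beta>) (ladder_edges n) t \<tau> Hx Hp Hy Hq"
    and pos: "0 < t" "0 < \<tau>" "0 < n" "0 < N" "0 \<le> r"
    and s: "0 \<le> s" and i: "i < 2 * n"
  shows "Hx i s \<subseteq> {v. \<forall>k\<in>Poly_Mapping.keys v. k < N \<and>
      arrival_x t \<tau> (real (n - 1)) k (real (i div 2)) \<le> s}"
    (is "_ \<subseteq> ?VX i s")
    and "Hy i s \<subseteq> {v. \<forall>k\<in>Poly_Mapping.keys v. k < N \<and>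
      arrival_y t \<tau> (real (n - 1)) k (real (i div 2)) \<le> s}"
    (is "_ \<subseteq> ?VY i s")
proof -
  define D where "D = real (n - 1)"
  define c where "c = 2 * real n * \<mu>"
  define \<delta> where "\<delta> = min t \<tau>"
  have \<delta>: "0 < \<delta>" "\<delta> \<le> t" "\<delta> \<le> \<tau>" using pos by (auto simp: \<delta>_def)
  have main: "Hx i s \<subseteq> ?VX i s \<and> Hy i s \<subseteq> ?VY i s"
    if "0 \<le> s" "s < real m * \<delta>" "i < 2 * n" for m s i
    using that
  proof (induction m arbitrary: s i)
    case (Suc m)
    note i = \<open>i < 2 * n\<close>
    have small: "s - t < real m * \<delta>" "s - \<tau> < real m * \<delta>"
      using Suc.prems(2) \<delta> by (simp_all add: algebra_simps)
    have IH: "Hx i (s - t) \<subseteq> ?VX i (s - t)" "Hy i (s - t) \<subseteq> ?VY i (s - t)" if "t \<le> s"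
      using Suc.IH[of "s - t" i] small i that by auto
    have comm: "Hx j (s - \<tau>) \<subseteq> ?VX i s" "Hy j (s - \<tau>) \<subseteq> ?VY i s"
      if "\<tau> \<le> s" "(j, i) \<in> ladder_edges n" for j
    proof -
      have j: "j < 2 * n" "real (i div 2) \<le> real (j div 2) + 1" "real (j div 2) \<le> real (i div 2) + 1"
        using that(2) by (auto simp: ladder_edges_def)
      have "Hx j (s - \<tau>) \<subseteq> ?VX j (s - \<tau>)" "Hy j (s - \<tau>) \<subseteq> ?VY j (s - \<tau>)"
        using Suc.IH[of "s - \<tau>" j] small j that by auto
      moreover have "?VX j (s - \<tau>) \<subseteq> ?VX i s"
        using arrival_comm(1)[OF pos(2) j(2), of t] by (fastforce simp: le_diff_eq intro: order_trans)
      moreover have "?VY j (s - \<tau>) \<subseteq> ?VY i s"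
        using arrival_comm(2)[OF pos(2) j(3), of t] by (fastforce simp: le_diff_eq intro: order_trans)
      ultimately show "Hx j (s - \<tau>) \<subseteq> ?VX i s" "Hy j (s - \<tau>) \<subseteq> ?VY i s" by blast+
    qed
    have mono: "Hx i (s - t) \<subseteq> ?VX i s" "Hy i (s - t) \<subseteq> ?VY i s" if "t \<le> s"
    proof -
      have "a \<le> s" if "a \<le> s - t" for a using that pos(1) by linarith
      then show "Hx i (s - t) \<subseteq> ?VX i s" "Hy i (s - t) \<subseteq> ?VY i s"
        using IH[OF that] by blast+
    qed
    have grads: "grad N (\<lambda>u. chain_fun n N c \<beta> i u y) x \<in> ?VX i s"
      "grad N (\<lambda>u. chain_fun n N c \<beta> i x u) y \<in> ?VY i s"
      if ts: "t \<le> s" and "x \<in> Hx i (s - t)" "y \<in> Hy i (s - t)" for x y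
    proof -
      have x: "x \<in> ?VX i (s - t)" and y: "y \<in> ?VY i (s - t)"
        using IH[OF ts] that by blast+
      have xk: "k < N" "arrival_x t \<tau> D k (real (i div 2)) \<le> s - t" if "Poly_Mapping.lookup x k \<noteq> 0" for k
        using x that by (auto simp: in_keys_iff D_def)
      have yk: "k < N" "arrival_y t \<tau> D k (real (i div 2)) \<le> s - t" if "Poly_Mapping.lookup y k \<noteq> 0" for k
        using y that by (auto simp: in_keys_iff D_def)
      have xR: "x \<in> Rn N" and yR: "y \<in> Rn N"
        using x y by (auto simp: Rn_def)
      \<comment> \<open>The last node, which holds the source and the shifted links, lies on level
        \<open>D\<close>.\<close>
      have D: "real ((2 * n - 1) div 2) = D" using pos(3) by (cases n) (auto simp: D_def)
      have gx: "k < N \<and> arrival_x t \<tau> D k (real (i div 2)) \<le> s"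
        if k: "Poly_Mapping.lookup (grad N (\<lambda>u. chain_fun n N c \<beta> i u y) x) k \<noteq> 0" for k
      proof (cases "i = 0")
        case True
        then have "Poly_Mapping.lookup y k \<noteq> 0"
          using k by (auto simp: grad_chain_fun_x[OF xR yR])
        then show ?thesis using yk[of k] arrival_local(1)[of t \<tau> D k] True by auto
      next
        case False
        then have i': "i = 2 * n - 1" and "Suc k < N" "Poly_Mapping.lookup y (Suc k) \<noteq> 0"
          using k by (auto simp: grad_chain_fun_x[OF xR yR] lookup_shift_down split: if_splits)
        \<comment> \<open>Nothing new is learnt here: on the last level, \<open>y\<close> at
          \<open>Suc k\<close> arrives later than \<open>x\<close> at \<open>k\<close>.\<close>
        then show ?thesis using yk[of "Suc k"] arrival_local(2)[of t \<tau> D k] pos(1) D by auto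
      qed
      have gy: "k < N \<and> arrival_y t \<tau> D k (real (i div 2)) \<le> s"
        if k: "Poly_Mapping.lookup (grad N (\<lambda>u. chain_fun n N c \<beta> i x u) y) k \<noteq> 0" for k
      proof (cases "i = 0")
        case True
        then have "Poly_Mapping.lookup x k \<noteq> 0"
          using k by (auto simp: grad_chain_fun_y[OF xR yR pos(4)])
        \<comment> \<open>Again nothing new: on level \<open>0\<close>, \<open>x\<close> at
          \<open>k\<close> arrives later than \<open>y\<close> at \<open>k\<close>.\<close>
        then show ?thesis using xk[of k] arrival_local(1)[of t \<tau> D k] True pos(1) by auto
      next
        case False
        then have i': "i = 2 * n - 1"
          using k by (auto simp: grad_chain_fun_y[OF xR yR pos(4)] split: if_splits)
        show ?thesis
        proof (cases k)
          \<comment> \<open>The source reveals this coordinate whatever \<open>x\<close> is, at the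
            cost of one local step.\<close>
          case 0
          then show ?thesis using arrival_local(3)[of t \<tau> D] ts pos(4) i' D by simp
        next
          case (Suc k')
          then have "Suc k' < N" "Poly_Mapping.lookup x k' \<noteq> 0"
            using k False i' by (auto simp: grad_chain_fun_y[OF xR yR pos(4)] lookup_shift_up lookup_add
                split: if_splits)
          then show ?thesis
            using xk[of k'] arrival_local(2)[of t \<tau> D k'] Suc i' D by auto
        qed
      qed
      show "grad N (\<lambda>u. chain_fun n N c \<beta> i u y) x \<in> ?VX i s"
        "grad N (\<lambda>u. chain_fun n N c \<beta> i x u) y \<in> ?VY i s"
        using gx gy by (auto simp: in_keys_iff D_def)
    qed
    have bbi: "Hx i s \<subseteq> comm_set (ladder_edges n) \<tau> Hx i s \<union> local_set t s (Rn_ball N r)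
          {grad N (\<lambda>u. chain_fun n N c \<beta> i u y) x | x p y q.
            x \<in> Hx i (s - t) \<and> p \<in> Hp i (s - t) \<and> y \<in> Hy i (s - t) \<and> q \<in> Hq i (s - t)} (Hx i (s - t))"
      "Hy i s \<subseteq> comm_set (ladder_edges n) \<tau> Hy i s \<union> local_set t s (Rn_ball N r)
          {grad N (\<lambda>u. chain_fun n N c \<beta> i x u) y | x p y q.
            x \<in> Hx i (s - t) \<and> p \<in> Hp i (s - t) \<and> y \<in> Hy i (s - t) \<and> q \<in> Hq i (s - t)} (Hy i (s - t))"
      using bb i Suc.prems(1) by (simp_all add: black_box_def Let_def c_def)
    have "Hx i s \<subseteq> ?VX i s"
      by (rule order_trans[OF bbi(1)], intro Un_least comm_set_subset local_set_subset)
        (use comm mono grads pos in auto)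
    moreover have "Hy i s \<subseteq> ?VY i s"
      by (rule order_trans[OF bbi(2)], intro Un_least comm_set_subset local_set_subset)
        (use comm mono grads pos in auto)
    ultimately show ?case ..
  qed simp
  obtain m where "s < real m * \<delta>"
    using reals_Archimedean3[OF \<delta>(1)] by blast
  from main[OF s this i] show "Hx i s \<subseteq> ?VX i s" "Hy i s \<subseteq> ?VY i s" by blast+
qed

section \<open>The bound on the running time and the choice of parameters\<close>

text \<open>The claimed bound is the arrival time of the last coordinate of \<open>x\<close> on
  level \<open>0\<close>, the earliest over all levels. Before it every output \<open>x\<close> has
  last coordinate zero, so its residual has norm at least \<open>r / N\<close>.\<close>

lemma black_box_lower_bound:
  assumes bb: "black_box (chain_problem n N r \<mu> \<beta>) (ladder_edges n) t \<tau> Hx Hp Hy Hq"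
    and out: "global_output (chain_problem n N r \<mu> \<beta>) Hx Hp Hy Hq T x p y q"
    and pos: "0 < t" "0 < \<tau>" "0 < n" "0 < N" "0 < r" "0 < \<mu>" "0 \<le> T"
    and \<beta>: "\<beta> = r / sqrt (real N)"
    and gap: "saddle_gap (chain_problem n N r \<mu> \<beta>) x p y q < \<mu> * r\<^sup>2 / real N"
  shows "2 * real N * t + (2 * real N - 1) * real (n - 1) * \<tau> \<le> T"
proof (rule ccontr)
  assume T: "\<not> ?thesis"
  have sub: "Hx i T \<subseteq> Rn (N - 1)" if "i < 2 * n" for i
  proof
    fix v assume v: "v \<in> Hx i T"
    have "k < N - 1" if "k \<in> Poly_Mapping.keys v" for k
    proof (rule ccontr)
      assume k: "\<not> k < N - 1"
      have "k < N" and a: "arrival_x t \<tau> (real (n - 1)) k (real (i div 2)) \<le> T"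
        using black_box_progress(1)[OF bb pos(1-4) _ pos(7) \<open>i < 2 * n\<close>] pos(5) v that by auto
      with k have "real N = real k + 1" by (simp add: of_nat_diff)
      then have "arrival_x t \<tau> (real (n - 1)) k (real (i div 2)) =
          2 * real N * t + (2 * real N - 1) * real (n - 1) * \<tau> + real (i div 2) * \<tau>"
        by (simp add: arrival_x_def algebra_simps)
      moreover have "0 \<le> real (i div 2) * \<tau>" using pos(2) by simp
      ultimately show False using a T by linarith
    qed
    then show "v \<in> Rn (N - 1)" by (auto simp: Rn_def)
  qed
  have "x \<in> span (\<Union>i<2 * n. Hx i T)" using out by (simp add: global_output_def)
  moreover have "span (\<Union>i<2 * n. Hx i T) \<subseteq> Rn (N - 1)"
    using sub by (intro span_minimal subspace_Rn) auto
  ultimately have x: "x \<in> Rn (N - 1)" by blast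
  then have xN: "x \<in> Rn N" by (auto simp: Rn_iff)
  let ?G = "residual N \<beta> x"
  have \<beta>0: "0 < \<beta>" using \<beta> pos by simp
  have "\<beta> \<le> norm ?G * sqrt (real N)"
    using norm_residual_ge[OF pos(4) x] \<beta>0 by simp
  then have G: "r / real N \<le> norm ?G"
    using pos(4) by (simp add: \<beta> pos_divide_le_eq mult.assoc)
  moreover have "0 < r / real N" using pos by simp
  ultimately have G0: "?G \<noteq> 0" by auto
  have "\<mu> * r\<^sup>2 / real N = \<mu> * (r * (r / real N))" by (simp add: power2_eq_square)
  also have "\<dots> \<le> \<mu> * (r * norm ?G)" using G pos by (intro mult_left_mono) auto
  also have "\<dots> \<le> saddle_gap (chain_problem n N r \<mu> \<beta>) x p y q"
    using \<beta>0 \<beta> pos by (intro saddle_gap_chain_ge xN G0) auto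
  finally show False using gap by simp
qed

theorem theorem4p2:
  shows "\<exists>c::real. c > 0 \<and>
    (\<forall>(L::real) (R::real) (\<kappa>::real) (\<epsilon>::real).
      L > 0 \<and> R > 0 \<and> \<kappa> \<ge> 1 \<and> \<epsilon> > 0 \<and> L \<ge> 32 * \<epsilon> / R\<^sup>2 \<longrightarrow>
      (\<exists>(A::saddle_problem) (E::(nat \<times> nat) set) (W::real mat).
        admissible_sets A R \<and> differentiable_nodes A \<and>
        convex_concave A \<and> avg_smooth A L \<and>
        connected_graph (nodes A) E \<and> gossip_matrix (nodes A) E W \<and> chi W = \<kappa> \<and>
        (\<forall>(t::real) (\<tau>::real) Hx Hp Hy Hq (T::real) x p y q.
          t > 0 \<and> \<tau> > 0 \<and> black_box A E t \<tau> Hx Hp Hy Hq \<and>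
          T \<ge> 0 \<and> global_output A Hx Hp Hy Hq T x p y q \<and>
          saddle_gap A x p y q \<le> \<epsilon> \<longrightarrow>
          T \<ge> c * (L * R\<^sup>2 / \<epsilon>) * (t + sqrt \<kappa> * \<tau>))))"
proof (intro exI[of _ "1/2 :: real"] conjI allI impI)
  fix L R \<kappa> \<epsilon> :: real
  assume "L > 0 \<and> R > 0 \<and> \<kappa> \<ge> 1 \<and> \<epsilon> > 0 \<and> L \<ge> 32 * \<epsilon> / R\<^sup>2"
  then have L: "0 < L" and R: "0 < R" and \<kappa>: "1 \<le> \<kappa>" and \<epsilon>: "0 < \<epsilon>" and L32: "32 * \<epsilon> / R\<^sup>2 \<le> L"
    by auto
  define K where "K = L * R\<^sup>2 / \<epsilon>"
  have K: "32 \<le> K" using L32 R \<epsilon> by (simp add: K_def field_simps)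
  \<comment> \<open>The largest integer strictly below \<open>K\<close>; strictness makes the gap
    bound \<open>L * R^2 / N\<close> exceed \<open>\<epsilon>\<close>.\<close>
  define N where "N = nat (\<lceil>K\<rceil> - 1)"
  have N: "real N < K" "K - 1 \<le> real N"
    using K unfolding N_def by linarith+
  then have N0: "0 < N" using K by linarith
  define m where "m = nat \<lfloor>sqrt \<kappa>\<rfloor>"
  have sq: "1 \<le> sqrt \<kappa>" using \<kappa> by simp
  have "real m = of_int \<lfloor>sqrt \<kappa>\<rfloor>" "1 \<le> \<lfloor>sqrt \<kappa>\<rfloor>"
    using sq by (simp_all add: m_def)
  then have m: "real m \<le> sqrt \<kappa>" "sqrt \<kappa> < real m + 1" "1 \<le> real m"
    by linarith+
  \<comment> \<open>The diameter \<open>n - 1 = m\<close> is the integer part of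
    \<open>sqrt \<kappa>\<close>.\<close>
  define n where "n = Suc m"
  have n: "2 \<le> n" using m(3) by (simp add: n_def)
  have "(real m)\<^sup>2 \<le> (sqrt \<kappa>)\<^sup>2" using m by (intro power_mono) auto
  then have "(real m)\<^sup>2 \<le> \<kappa>" using \<kappa> by simp
  \<comment> \<open>With \<open>n = m + 1\<close> the difference of \<open>2 * m^2\<close> and
    \<open>n^2 - 2\<close> is the square of \<open>m - 1\<close>.\<close>
  then have n2: "real n ^ 2 - 2 \<le> 2 * \<kappa>"
    using zero_le_power2[of "real m - 1"] by (simp add: n_def power2_eq_square algebra_simps)
  define r where "r = sqrt 2 * R"
  define \<beta> where "\<beta> = r / sqrt (real N)"
  have r: "0 < r" using R by (simp add: r_def)
  \<comment> \<open>The smoothness constant of the chain is twice its scale, hence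
    \<open>L / 2\<close>.\<close>
  let ?A = "chain_problem n N r (L / 2) \<beta>"
  show "\<exists>A E W. admissible_sets A R \<and> differentiable_nodes A \<and>
        convex_concave A \<and> avg_smooth A L \<and>
        connected_graph (nodes A) E \<and> gossip_matrix (nodes A) E W \<and> chi W = \<kappa> \<and>
        (\<forall>(t::real) (\<tau>::real) Hx Hp Hy Hq (T::real) x p y q.
          t > 0 \<and> \<tau> > 0 \<and> black_box A E t \<tau> Hx Hp Hy Hq \<and>
          T \<ge> 0 \<and> global_output A Hx Hp Hy Hq T x p y q \<and>
          saddle_gap A x p y q \<le> \<epsilon> \<longrightarrow>
          T \<ge> 1 / 2 * (L * R\<^sup>2 / \<epsilon>) * (t + sqrt \<kappa> * \<tau>))"
  proof (intro exI[of _ ?A] exI[of _ "ladder_edges n"] exI[of _ "ladder_matrix n \<kappa>"] conjI allI impI)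
    show "admissible_sets ?A R" unfolding r_def by (rule admissible_chain[OF N0 R])
    show "differentiable_nodes ?A" by (rule differentiable_chain)
    show "convex_concave ?A" by (rule convex_concave_chain)
    show "avg_smooth ?A L" using avg_smooth_chain[of n N "L / 2" r \<beta>] n N0 L by simp
    show "connected_graph (nodes ?A) (ladder_edges n)" using connected_graph_ladder n by simp
    show "gossip_matrix (nodes ?A) (ladder_edges n) (ladder_matrix n \<kappa>)"
      using gossip_matrix_ladder \<kappa> n by simp
    show "chi (ladder_matrix n \<kappa>) = \<kappa>" by (rule chi_ladder[OF \<kappa> n n2])
    fix t \<tau> T :: real and Hx Hp Hy Hq x p y q
    assume H: "t > 0 \<and> \<tau> > 0 \<and> black_box ?A (ladder_edges n) t \<tau> Hx Hp Hy Hq \<and>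
      T \<ge> 0 \<and> global_output ?A Hx Hp Hy Hq T x p y q \<and> saddle_gap ?A x p y q \<le> \<epsilon>"
    have "\<epsilon> < L / 2 * r\<^sup>2 / real N"
      using N(1) N0 \<epsilon> by (simp add: r_def power_mult_distrib K_def field_simps)
    moreover from H have bb: "black_box ?A (ladder_edges n) t \<tau> Hx Hp Hy Hq"
      and out: "global_output ?A Hx Hp Hy Hq T x p y q" by blast+
    ultimately have T: "2 * real N * t + (2 * real N - 1) * real (n - 1) * \<tau> \<le> T"
      using H n N0 r L by (intro black_box_lower_bound[OF bb out _ _ _ _ _ _ _ \<beta>_def]) auto
    \<comment> \<open>The constant \<open>1 / 2\<close> absorbs the rounding of
      \<open>sqrt \<kappa>\<close>, which is less than \<open>m + 1\<close> and so at most
      \<open>2 * m\<close>; the rounding of \<open>K\<close> is harmless, since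
      \<open>N >= K - 1\<close> and \<open>K >= 32\<close> give
      \<open>2 * N - 1 >= K\<close>.\<close>
    have "1 / 2 * K * sqrt \<kappa> \<le> 1 / 2 * K * (2 * real m)"
      using K m by (intro mult_left_mono) auto
    also have "\<dots> \<le> (2 * real N - 1) * real m"
      using K N m by (simp add: mult_right_mono)
    finally have "1 / 2 * K * sqrt \<kappa> * \<tau> \<le> (2 * real N - 1) * real (n - 1) * \<tau>"
      using H by (intro mult_right_mono) (auto simp: n_def)
    moreover have "1 / 2 * K * t \<le> 2 * real N * t"
      using H K N by (intro mult_right_mono) auto
    ultimately show "1 / 2 * (L * R\<^sup>2 / \<epsilon>) * (t + sqrt \<kappa> * \<tau>) \<le> T"
      using T unfolding K_def[symmetric] by (simp add: distrib_left mult.assoc)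
  qed
qed simp

end
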